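(* Let $\Delta$ be a positive-dimensional lattice simplex possessing the integer decomposition property. Then $\Delta$ is clean if and only if every facet of $\Delta$ is unimodular. Furthermore, if $\Delta$ is clean, then its $h^*$-vector is unimodal.
   Context: A lattice $M$ is a free abelian group of finite rank, and $M_{\mathbb{R}}=M\otimes_{\mathbb{Z}}\mathbb{R}$. A lattice polytope $P\subset M_{\mathbb{R}}$ is the convex hull of a finite set of points of $M$; a $d$-dimensional lattice polytope with exactly $d+1$ vertices is a lattice simplex. Interior, boundary and facets are taken relative to the affine span. Integer decomposition property (IDP): for every positive integer $n$, every $z\in nP\cap M$ can be written $z=z_1+\cdots+z_n$ with all $z_i\in P\cap M$. A positive-dimensional lattice simplex is clean if its only (relative) boundary lattice points are its vertices. Normalized volume: for a $d$-dimensional lattice polytope $P$ with $v\in P\cap M$ and $M_P=M\cap\operatorname{span}_{\mathbb{R}}(P-v)$, $\operatorname{Vol}(P)$ is $d!$ times the $d$-dimensional volume of $P-v$ in $\operatorname{span}_{\mathbb{R}}(P-v)$, normalized so that a fundamental parallelepiped of $M_P$ has volume one. A simplex is unimodular if its normalized volume (with respect to its own induced lattice) is one; a single lattice point, as a zero-dimensional simplex, has normalized volume one. $h^*$-vector: $\sum_{n\ge 0}|nP\cap M|t^n=h^*_P(t)/(1-t)^{d+1}$ with $h_P^*(t)=\sum_{i=0}^d h_i^*(P)t^i$ and $d=\dim P$; the $h^*$-vector is $(h_0^*(P),\dots,h_d^*(P))$. A finite sequence $(a_0,\dots,a_d)$ is unimodal if there is $k$ with $a_0\le\cdots\le a_k\ge\cdots\ge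 a_d$. *)

theory Defs
  imports "HOL-Analysis.Analysis" "HOL-Computational_Algebra.Computational_Algebra"
begin

definition int_span :: "'a::real_vector set \<Rightarrow> 'a set" where
  "int_span B = range (\<lambda>c. \<Sum>b\<in>B. real_of_int (c b) *\<^sub>R b)"

definition lattice_basis :: "'a::euclidean_space set \<Rightarrow> 'a set \<Rightarrow> bool" where
  "lattice_basis L B \<longleftrightarrow> finite B \<and> independent B \<and> L = int_span B"

text \<open>The ambient type plays the role of \<open>M \<otimes> \<real>\<close>. Only its structure as a
  finite-dimensional real vector space (with its topology) matters: \<open>M\<close> is the integer span
  of an arbitrary real basis.\<close>

definition full_lattice :: "'a::euclidean_space set \<Rightarrow> bool" where
  "full_lattice M \<longleftrightarrow> (\<exists>B. lattice_basis M B \<and> span B = UNIV)"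

definition lattice_polytope :: "'a::euclidean_space set \<Rightarrow> 'a set \<Rightarrow> bool" where
  "lattice_polytope M P \<longleftrightarrow> (\<exists>S. finite S \<and> S \<noteq> {} \<and> S \<subseteq> M \<and> P = convex hull S)"

definition vertices :: "'a::euclidean_space set \<Rightarrow> 'a set" where
  "vertices P = {v. v extreme_point_of P}"

definition lattice_simplex :: "'a::euclidean_space set \<Rightarrow> 'a set \<Rightarrow> bool" where
  "lattice_simplex M P \<longleftrightarrow> lattice_polytope M P \<and> int (card (vertices P)) = aff_dim P + 1"

definition dilate :: "nat \<Rightarrow> 'a::real_vector set \<Rightarrow> 'a set" where
  "dilate n P = (\<lambda>x. real n *\<^sub>R x) ` P"

definition idp :: "'a::euclidean_space set \<Rightarrow> 'a set \<Rightarrow> bool" where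
  "idp M P \<longleftrightarrow> (\<forall>n\<ge>1. \<forall>z \<in> dilate n P \<inter> M.
     \<exists>y :: nat \<Rightarrow> 'a. (\<forall>i<n. y i \<in> P \<inter> M) \<and> z = (\<Sum>i<n. y i))"

definition clean :: "'a::euclidean_space set \<Rightarrow> 'a set \<Rightarrow> bool" where
  "clean M P \<longleftrightarrow> rel_frontier P \<inter> M = vertices P"

definition induced_lattice :: "'a::euclidean_space set \<Rightarrow> 'a set \<Rightarrow> 'a \<Rightarrow> 'a set" where
  "induced_lattice M P v = M \<inter> span ((\<lambda>x. x - v) ` P)"

text \<open>Lebesgue measure on the span of a linearly independent finite set \<open>B\<close>, computed in the
  coordinates with respect to \<open>B\<close>; thus the parallelepiped spanned by \<open>B\<close> has volume one.
  For \<open>B = {}\<close> the set \<open>{0}\<close> has volume one.\<close>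

definition basis_volume :: "'a::euclidean_space set \<Rightarrow> 'a set \<Rightarrow> real" where
  "basis_volume B S =
     measure (\<Pi>\<^sub>M b\<in>B. lborel) {c \<in> extensional B. (\<Sum>b\<in>B. c b *\<^sub>R b) \<in> S}"

text \<open>For a lattice polytope the value depends neither on the lattice point \<open>v\<close> of \<open>P\<close> nor on
  the basis \<open>B\<close> of the induced lattice (two bases differ by a matrix of determinant \<open>\<plusminus>1\<close>).\<close>

definition normalized_volume :: "'a::euclidean_space set \<Rightarrow> 'a set \<Rightarrow> real" where
  "normalized_volume M P =
     (let v = (SOME v. v \<in> P \<inter> M);
          B = (SOME B. lattice_basis (induced_lattice M P v) B)
      in fact (nat (aff_dim P)) * basis_volume B ((\<lambda>x. x - v) ` P))"

definition unimodular :: "'a::euclidean_space set \<Rightarrow> 'a set \<Rightarrow> bool" where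
  "unimodular M P \<longleftrightarrow> normalized_volume M P = 1"

definition ehrhart_series :: "'a::euclidean_space set \<Rightarrow> 'a set \<Rightarrow> real fps" where
  "ehrhart_series M P = Abs_fps (\<lambda>n. real (card (dilate n P \<inter> M)))"

definition hstar_poly :: "'a::euclidean_space set \<Rightarrow> 'a set \<Rightarrow> real poly" where
  "hstar_poly M P = (THE h. degree h \<le> nat (aff_dim P) \<and>
     ehrhart_series M P = fps_of_poly h / (1 - fps_X) ^ (nat (aff_dim P) + 1))"

definition hstar_vector :: "'a::euclidean_space set \<Rightarrow> 'a set \<Rightarrow> real list" where
  "hstar_vector M P = map (coeff (hstar_poly M P)) [0..<nat (aff_dim P) + 1]"

definition unimodal :: "'a::linorder list \<Rightarrow> bool" where
  "unimodal a \<longleftrightarrow> (\<exists>k<length a. sorted (take (Suc k) a) \<and> sorted_wrt (\<ge>) (drop k a))"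

end

theory Submission
  imports Defs "HOL-Library.Poly_Mapping" "HOL-Library.Z2"
begin

text \<open>Facets. In a clean simplex with the integer decomposition property every lattice point of a multiple
  of a facet is a sum of vertices, so the edge vectors of the facet generate its induced lattice. The
  volume of a \<open>k\<close>-dimensional lattice simplex is compared with lattice point counts by covering its
  dilates with unit cubes: the sublattice generated by the edge vectors accounts for volume \<open>1 / k!\<close>, and a
  lattice point of the simplex that is not a vertex contributes a further coset, hence at least the same again.

  Unimodality. In the cone over the simplex, with \<open>D\<close> vertices \<open>v\<close>, the number \<open>h i\<close> counts the lattice points
  of height \<open>i\<close> in the half-open parallelepiped spanned by the vertices (box points). Nonzero box points are
  interior, so \<open>x \<mapsto> (\<Sum>v) - x\<close> gives \<open>h i = h (D - i)\<close>, and \<open>h i \<le> h (i + 1)\<close> is needed for \<open>2 * i < D\<close>. This follows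
  an idea of Adiprasito, Papadakis, Petrotou and Steinmeyer. In characteristic two let
  \<open>\<theta> v = x^v + \<epsilon> * (\<Sum>h. y v h * x^h)\<close> with independent variables \<open>y v h\<close>, where \<open>h\<close> runs over the box points of
  height one, let \<open>\<Phi>\<close> be the inverse of the product of all \<open>\<theta> v\<close>, and let \<open>l\<close> be a generic combination of the \<open>x^h\<close>.
  The coefficient of \<open>x^0\<close> in \<open>F * \<Phi>\<close> vanishes if \<open>F\<close> is \<open>\<theta> v\<close> times something interior. If \<open>h i > h (i + 1)\<close>, linear
  algebra yields a nonzero combination \<open>u\<close> of box points of height \<open>i\<close> such that \<open>u * l * x^w * \<Phi>\<close> has zero
  constant coefficient for all \<open>w\<close> of height \<open>D - i - 1\<close>. Then so has \<open>u\<^sup>2 * l * x^m * \<Phi>\<close> for all \<open>m\<close> of height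
  \<open>D - 2 * i - 1\<close>. As \<open>\<Phi> = (\<Prod>v. \<theta> v) * \<Phi>\<^sup>2\<close>, this coefficient is a combination of squares of coefficients of
  \<open>u * \<Phi>\<close> with distinct squarefree monomials as multipliers, so all of these vanish and \<open>u = 0\<close>.\<close>

section \<open>Algebra in characteristic two\<close>

lemma char_two_double:
  fixes x :: "'r::semiring_1"
  assumes "(2::'r) = 0"
  shows "x + x = 0"
proof -
  have "x + x = 2 * x" by (rule mult_2[symmetric])
  then show ?thesis using assms by simp
qed

lemma char_two_sum_square:
  fixes f :: "'i \<Rightarrow> 'r::comm_semiring_1"
  assumes "(2::'r) = 0"
  shows "(\<Sum>i\<in>A. f i)\<^sup>2 = (\<Sum>i\<in>A. (f i)\<^sup>2)"
proof (induction A rule: infinite_finite_induct)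
  case (insert a A)
  have "(f a + sum f A)\<^sup>2 = (f a)\<^sup>2 + (sum f A)\<^sup>2 + (f a * sum f A + f a * sum f A)"
    by (simp add: power2_eq_square algebra_simps)
  then show ?case using insert char_two_double[OF assms] by simp
qed auto

lemma char_two_poly_mapping:
  assumes "(2::'r::semiring_1) = 0"
  shows "(2::'g::monoid_add \<Rightarrow>\<^sub>0 'r) = 0"
  by (rule poly_mapping_eqI) (simp add: lookup_numeral assms)

lemma poly_mapping_expand: "f = (\<Sum>k\<in>Poly_Mapping.keys f. Poly_Mapping.single k (Poly_Mapping.lookup f k))"
  by (rule poly_mapping_eqI)
    (simp add: lookup_sum lookup_single when_def in_keys_iff)

lemma lookup_single_mult:
  fixes g :: "'g::cancel_comm_monoid_add \<Rightarrow>\<^sub>0 'r::comm_semiring_1"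
  shows "Poly_Mapping.lookup (Poly_Mapping.single k c * g) (k + a) = c * Poly_Mapping.lookup g a"
proof -
  have "(\<Sum>q. Poly_Mapping.lookup g q when k + a = k + q) = Poly_Mapping.lookup g a"
    by simp
  moreover have "Poly_Mapping.lookup (Poly_Mapping.single k c) l * (\<Sum>q. Poly_Mapping.lookup g q when k + a = l + q)
      = (c * (\<Sum>q. Poly_Mapping.lookup g q when k + a = k + q) when k = l)" for l
    by (simp add: lookup_single when_def)
  ultimately show ?thesis
    by (simp add: lookup_mult)
qed

text \<open>Squaring is additive in characteristic two, so \<open>f\<^sup>2\<close> is the sum of
  the squared terms. As doubling of exponents is injective, different terms land on different
  exponents and no coefficients merge.\<close>

lemma char_two_lookup_square:
  fixes f :: "'g::comm_monoid_add \<Rightarrow>\<^sub>0 'r::comm_semiring_1"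
  assumes "(2::'r) = 0" and inj: "\<And>a b::'g. a + a = b + b \<Longrightarrow> a = b"
  shows "Poly_Mapping.lookup (f\<^sup>2) (a + a) = (Poly_Mapping.lookup f a)\<^sup>2"
    and "Poly_Mapping.lookup (f\<^sup>2) c \<noteq> 0 \<Longrightarrow> \<exists>a. c = a + a"
proof -
  have eq: "f\<^sup>2 = (\<Sum>k\<in>Poly_Mapping.keys f. Poly_Mapping.single (k + k) ((Poly_Mapping.lookup f k)\<^sup>2))"
    by (subst poly_mapping_expand, subst char_two_sum_square[OF char_two_poly_mapping[OF assms(1)]])
      (simp add: power2_eq_square mult_single)
  have "(\<Sum>k\<in>Poly_Mapping.keys f. (Poly_Mapping.lookup f k)\<^sup>2 when k + k = a + a)
      = (\<Sum>k\<in>Poly_Mapping.keys f. (Poly_Mapping.lookup f k)\<^sup>2 when k = a)"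
    by (rule sum.cong) (auto simp: when_def dest: inj)
  then show "Poly_Mapping.lookup (f\<^sup>2) (a + a) = (Poly_Mapping.lookup f a)\<^sup>2"
    by (auto simp: eq lookup_sum lookup_single when_def in_keys_iff)
  show "\<exists>a. c = a + a" if "Poly_Mapping.lookup (f\<^sup>2) c \<noteq> 0"
  proof (rule ccontr)
    assume "\<nexists>a. c = a + a"
    then have "Poly_Mapping.lookup (f\<^sup>2) c = 0"
      unfolding eq lookup_sum by (intro sum.neutral) (metis lookup_single_not_eq)
    with that show False by simp
  qed
qed

text \<open>In the convolution the terms of \<open>i\<close> and \<open>n - i\<close> are equal and
  cancel; only the diagonal term survives.\<close>

lemma char_two_fps_square:
  fixes F :: "'r::comm_semiring_1 fps"
  assumes "(2::'r) = 0"
  shows "(F\<^sup>2) $ n = (if even n then (F $ (n div 2))\<^sup>2 else 0)"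
proof -
  let ?g = "\<lambda>i. F $ i * F $ (n - i)"
  let ?A = "{i\<in>{0..n}. i < n - i}" and ?B = "{i\<in>{0..n}. n - i < i}" and ?C = "{i\<in>{0..n}. i = n - i}"
  have BA: "sum ?g ?B = sum ?g ?A"
    by (rule sum.reindex_bij_witness[where i = "\<lambda>i. n - i" and j = "\<lambda>i. n - i"])
      (auto simp: mult.commute)
  have "(F\<^sup>2) $ n = sum ?g {0..n}"
    by (simp add: power2_eq_square fps_mult_nth)
  also have "{0..n} = ?A \<union> ?B \<union> ?C" by auto
  also have "sum ?g (?A \<union> ?B \<union> ?C) = sum ?g ?A + sum ?g ?B + sum ?g ?C"
    by (subst sum.union_disjoint; (subst sum.union_disjoint)?) auto
  also have "\<dots> = sum ?g ?C"
    using char_two_double[OF assms] BA by simp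
  also have "\<dots> = (if even n then (F $ (n div 2))\<^sup>2 else 0)"
  proof (cases "even n")
    case True
    then have "?C = {n div 2}" by auto
    moreover have "n - n div 2 = n div 2" using True by auto
    ultimately show ?thesis using True by (simp add: power2_eq_square)
  next
    case False
    then have "?C = {}" by (auto simp: even_iff_mod_2_eq_zero; presburger)
    then show ?thesis using False by (simp only: sum.empty if_False)
  qed
  finally show ?thesis .
qed

text \<open>Fraction-free Gaussian elimination: the coefficients form only an integral domain, so
  rows are cross-multiplied instead of divided by the pivot.\<close>

lemma underdetermined_linear_system:
  fixes A :: "'j \<Rightarrow> 'i \<Rightarrow> 'r::idom"
  assumes "finite J" "finite I" "card J < card I"
  obtains u where "\<exists>i\<in>I. u i \<noteq> 0" and "\<And>j. j \<in> J \<Longrightarrow> (\<Sum>i\<in>I. A j i * u i) = 0"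
proof -
  have "\<exists>u. (\<exists>i\<in>I. u i \<noteq> 0) \<and> (\<forall>j\<in>J. (\<Sum>i\<in>I. A j i * u i) = 0)"
    using assms
  proof (induction J arbitrary: I A rule: finite_induct)
    case empty
    then obtain i where "i \<in> I" by fastforce
    then show ?case by (intro exI[of _ "\<lambda>_. 1"]) auto
  next
    case (insert j J)
    show ?case
    proof (cases "\<forall>i\<in>I. A j i = 0")
      case True
      moreover have "card J < card I" using insert by simp
      ultimately show ?thesis using insert.IH[of I A] insert.prems by force
    next
      case False
      then obtain k where k: "k \<in> I" "A j k \<noteq> 0" by blast
      let ?I = "I - {k}"
      have "card J < card ?I" using insert k by simp
      then obtain w where w: "\<exists>i\<in>?I. w i \<noteq> 0"
        "\<forall>l\<in>J. (\<Sum>i\<in>?I. (A j k * A l i - A l k * A j i) * w i) = 0"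
        using insert.IH[of ?I "\<lambda>l i. A j k * A l i - A l k * A j i"] insert.prems by blast
      \<comment> \<open>The solution \<open>w\<close> of the eliminated system is scaled by the
        pivot \<open>A j k\<close>, so that \<open>u k\<close> can be chosen in the ring to satisfy
        row \<open>j\<close>; absence of zero divisors keeps \<open>u\<close> nonzero.\<close>
      define u where "u i = (if i = k then - (\<Sum>i\<in>?I. A j i * w i) else A j k * w i)" for i
      have expand: "(\<Sum>i\<in>I. A l i * u i)
          = A j k * (\<Sum>i\<in>?I. A l i * w i) - A l k * (\<Sum>i\<in>?I. A j i * w i)" for l
      proof -
        have "(\<Sum>i\<in>I. A l i * u i) = A l k * u k + (\<Sum>i\<in>?I. A l i * u i)"
          using k insert.prems by (simp add: sum.remove)
        also have "(\<Sum>i\<in>?I. A l i * u i) = (\<Sum>i\<in>?I. A j k * (A l i * w i))"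
          by (rule sum.cong) (auto simp: u_def)
        finally show ?thesis by (simp add: u_def sum_distrib_left)
      qed
      have "(\<Sum>i\<in>I. A l i * u i) = 0" if "l \<in> insert j J" for l
      proof (cases "l = j")
        case False
        with that w(2) have "(\<Sum>i\<in>?I. (A j k * A l i - A l k * A j i) * w i) = 0" by blast
        then show ?thesis
          unfolding expand by (simp add: left_diff_distrib sum_subtractf sum_distrib_left mult.assoc)
      qed (simp add: expand)
      moreover have "\<exists>i\<in>I. u i \<noteq> 0" using w(1) k by (auto simp: u_def)
      ultimately show ?thesis by blast
    qed
  qed
  then show thesis using that by blast
qed

section \<open>Squares and squarefree monomials over the field with two elements\<close>

type_synonym coeffs = "(nat \<Rightarrow>\<^sub>0 nat) \<Rightarrow>\<^sub>0 bit"

lemma bit_char_two: "(2::bit) = 0" by simp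

lemma coeffs_char_two: "(2::coeffs) = 0"
  by (rule char_two_poly_mapping) (rule bit_char_two)

lemma double_eq_exponent: "a = b" if "a + a = b + b" for a b :: "'v \<Rightarrow>\<^sub>0 nat"
proof (rule poly_mapping_eqI)
  fix k
  have "Poly_Mapping.lookup (a + a) k = Poly_Mapping.lookup (b + b) k" using that by simp
  then show "Poly_Mapping.lookup a k = Poly_Mapping.lookup b k" by (simp add: lookup_add)
qed

text \<open>In a square every exponent of the polynomial variables is even. A squarefree multiplier
  is therefore recorded in the parities of the exponents, and terms with different
  \<open>\<mu> q\<close> have no monomial in common.\<close>

lemma squarefree_monomials_independent:
  fixes f :: "'q \<Rightarrow> coeffs fps" and \<mu> :: "'q \<Rightarrow> nat \<Rightarrow>\<^sub>0 nat" and e :: "'q \<Rightarrow> nat"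
  assumes fin: "finite Q" and inj: "inj_on \<mu> Q"
    and sqfree: "\<And>q i. q \<in> Q \<Longrightarrow> Poly_Mapping.lookup (\<mu> q) i \<le> 1"
    and zero: "(\<Sum>q\<in>Q. fps_X ^ e q * fps_const (Poly_Mapping.single (\<mu> q) 1) * (f q)\<^sup>2) = 0"
    and q: "q \<in> Q"
  shows "f q = 0"
proof (rule ccontr)
  assume "f q \<noteq> 0"
  then obtain n b where nb: "Poly_Mapping.lookup (f q $ n) b \<noteq> 0"
    by (metis fps_ext fps_zero_nth lookup_zero poly_mapping_eqI)
  let ?t = "\<lambda>p. fps_X ^ e p * fps_const (Poly_Mapping.single (\<mu> p) 1) * (f p)\<^sup>2"
  \<comment> \<open>The term of \<open>f q\<close> found at position \<open>n\<close>,
    \<open>b\<close> has its square at this position of the sum, and only the summand of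
    \<open>q\<close> reaches it.\<close>
  let ?c = "\<lambda>p. Poly_Mapping.lookup (?t p $ (e q + 2 * n)) (\<mu> q + (b + b))"
  have tnth: "?t p $ m = (if m < e p then 0 else Poly_Mapping.single (\<mu> p) 1 * ((f p)\<^sup>2 $ (m - e p)))" for p m
    by (simp add: mult.assoc fps_X_power_mult_nth)
  have shift: "Poly_Mapping.lookup (Poly_Mapping.single k 1 * g) (k + a) = Poly_Mapping.lookup g a"
    for k a :: "nat \<Rightarrow>\<^sub>0 nat" and g :: coeffs
    by (simp add: lookup_single_mult)
  have shift2: "\<exists>a. c = k + a \<and> Poly_Mapping.lookup g a \<noteq> 0"
    if "Poly_Mapping.lookup (Poly_Mapping.single k 1 * g) c \<noteq> 0"
    for k c :: "nat \<Rightarrow>\<^sub>0 nat" and g :: coeffs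
  proof -
    have "c \<in> Poly_Mapping.keys (Poly_Mapping.single k 1 * g)"
      using that by (rule in_keys_iff[THEN iffD2])
    then obtain b where "c = k + b" "b \<in> Poly_Mapping.keys g"
      using keys_mult[of "Poly_Mapping.single k 1" g] keys_single[of k "1::bit"] by force
    then show ?thesis by (metis in_keys_iff)
  qed
  have other: "?c p = 0" if "p \<in> Q" "p \<noteq> q" for p
  proof (rule ccontr)
    assume "?c p \<noteq> 0"
    moreover have "?t p $ (e q + 2 * n) = 0 \<or>
        ?t p $ (e q + 2 * n) = Poly_Mapping.single (\<mu> p) 1 * (f p $ ((e q + 2 * n - e p) div 2))\<^sup>2"
      unfolding tnth char_two_fps_square[OF coeffs_char_two] by simp
    ultimately have "Poly_Mapping.lookup (Poly_Mapping.single (\<mu> p) 1 *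
        (f p $ ((e q + 2 * n - e p) div 2))\<^sup>2) (\<mu> q + (b + b)) \<noteq> 0"
      by (elim disjE) (simp_all only: lookup_zero not_False_eq_True simp_thms)
    from shift2[OF this] obtain a where a: "\<mu> q + (b + b) = \<mu> p + a"
      "Poly_Mapping.lookup ((f p $ ((e q + 2 * n - e p) div 2))\<^sup>2) a \<noteq> 0"
      by blast
    obtain a' where a': "a = a' + a'"
      using char_two_lookup_square(2)[OF bit_char_two double_eq_exponent a(2)] by blast
    have "Poly_Mapping.lookup (\<mu> q) i = Poly_Mapping.lookup (\<mu> p) i" for i
    proof -
      have "Poly_Mapping.lookup (\<mu> q) i + 2 * Poly_Mapping.lookup b i
          = Poly_Mapping.lookup (\<mu> p) i + 2 * Poly_Mapping.lookup a' i"
        using arg_cong[OF a(1), of "\<lambda>x. Poly_Mapping.lookup x i"] by (simp add: lookup_add a')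
      then show ?thesis using sqfree[OF q, of i] sqfree[OF that(1), of i] by presburger
    qed
    then have "\<mu> q = \<mu> p" by (rule poly_mapping_eqI)
    with inj q that show False by (auto dest: inj_onD)
  qed
  have "0 = Poly_Mapping.lookup ((\<Sum>p\<in>Q. ?t p) $ (e q + 2 * n)) (\<mu> q + (b + b))"
    unfolding zero by simp
  also have "\<dots> = (\<Sum>p\<in>Q. ?c p)"
    by (simp only: fps_sum_nth lookup_sum)
  also have "\<dots> = ?c q"
    using fin q other by (simp add: sum.remove[of Q q])
  also have "\<dots> = (Poly_Mapping.lookup (f q $ n) b)\<^sup>2"
    using char_two_lookup_square(1)[OF bit_char_two double_eq_exponent, of "f q $ n" b]
    unfolding tnth by (simp add: shift char_two_fps_square[OF coeffs_char_two])
  finally show False using nb by simp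
qed

section \<open>Power series in \<epsilon> over Laurent polynomials\<close>

definition scalar :: "coeffs fps \<Rightarrow> ('b::ab_group_add \<Rightarrow>\<^sub>0 coeffs) fps" where
  "scalar k = Abs_fps (\<lambda>n. Poly_Mapping.single 0 (k $ n))"

definition lmonom :: "'b::ab_group_add \<Rightarrow> ('b \<Rightarrow>\<^sub>0 coeffs) fps" where
  "lmonom b = fps_const (Poly_Mapping.single b 1)"

text \<open>\<open>fps_X\<close> plays the role of \<epsilon>, and each coefficient in it is a
  Laurent polynomial in x over \<open>coeffs\<close>. \<open>scalar\<close>, \<open>lmonom\<close>
  and \<open>cf\<close> give the constants, the monomials x^b and the coefficient of x^w.\<close>

definition cf :: "'b::ab_group_add \<Rightarrow> ('b \<Rightarrow>\<^sub>0 coeffs) fps \<Rightarrow> coeffs fps" where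
  "cf w F = Abs_fps (\<lambda>n. Poly_Mapping.lookup (F $ n) w)"

lemma single_sum: "Poly_Mapping.single k (sum f A) = (\<Sum>i\<in>A. Poly_Mapping.single k (f i))"
  by (induction A rule: infinite_finite_induct) (simp_all add: single_add)

lemma scalar_mult: "scalar (j * k) = scalar j * scalar k"
  by (rule fps_ext) (simp add: scalar_def fps_mult_nth single_sum mult_single)

lemma scalar_1 [simp]: "scalar 1 = 1"
  by (rule fps_ext) (simp add: scalar_def)

lemma scalar_prod: "scalar (prod f A) = (\<Prod>i\<in>A. scalar (f i))"
  by (induction A rule: infinite_finite_induct) (simp_all add: scalar_mult)

lemma lmonom_add: "lmonom (a + b) = lmonom a * lmonom b"
  by (simp add: lmonom_def mult_single)

lemma lmonom_0 [simp]: "lmonom 0 = 1"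
  by (simp add: lmonom_def)

lemma lmonom_sum: "lmonom (sum f A) = (\<Prod>i\<in>A. lmonom (f i))"
  by (induction A rule: infinite_finite_induct) (simp_all add: lmonom_add)

lemma cf_nth: "cf w F $ n = Poly_Mapping.lookup (F $ n) w"
  by (simp add: cf_def)

lemma cf_add: "cf w (F + G) = cf w F + cf w G"
  by (rule fps_ext) (simp add: cf_nth lookup_add)

lemma cf_sum: "cf w (\<Sum>i\<in>A. F i) = (\<Sum>i\<in>A. cf w (F i))"
  by (rule fps_ext) (simp add: cf_nth fps_sum_nth lookup_sum)

lemma cf_scalar_mult: "cf w (scalar k * F) = k * cf w F"
proof (rule fps_ext)
  fix n
  show "cf w (scalar k * F) $ n = (k * cf w F) $ n"
    by (simp add: cf_nth scalar_def fps_mult_nth lookup_sum lookup_single_mult[of 0 _ _ w, simplified])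
qed

lemma cf_lmonom_mult: "cf w (lmonom b * F) = cf (w - b) F"
proof (rule fps_ext)
  fix n
  show "cf w (lmonom b * F) $ n = cf (w - b) F $ n"
    using lookup_single_mult[of b 1 "F $ n" "w - b"] by (simp add: cf_nth lmonom_def)
qed

lemma double_eq_vector: "a = b" if "a + a = b + b" for a b :: "'b::real_vector"
  using that by (simp flip: scaleR_2)

lemma laurent_char_two: "(2::'b::ab_group_add \<Rightarrow>\<^sub>0 coeffs) = 0"
  by (rule char_two_poly_mapping) (rule coeffs_char_two)

text \<open>Exponents range over a real vector space, so \<open>w /\<^sub>R 2\<close> always exists;
  if \<open>F\<close> has no term there, both sides vanish.\<close>

lemma cf_square:
  fixes w :: "'b::real_vector"
  shows "cf w (F\<^sup>2) = (cf (w /\<^sub>R 2) F)\<^sup>2"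
proof (rule fps_ext)
  fix n
  have w: "w /\<^sub>R 2 + w /\<^sub>R 2 = w"
    using scaleR_half_double[of w] by (simp add: scaleR_right_distrib)
  show "cf w (F\<^sup>2) $ n = (cf (w /\<^sub>R 2) F)\<^sup>2 $ n"
    using char_two_lookup_square(1)[OF coeffs_char_two double_eq_vector, of "F $ (n div 2)" "w /\<^sub>R 2"]
    unfolding w by (simp add: cf_nth char_two_fps_square[OF laurent_char_two] char_two_fps_square[OF coeffs_char_two])
qed

section \<open>Supports of Laurent series\<close>

definition supported :: "'b::ab_group_add set \<Rightarrow> ('b \<Rightarrow>\<^sub>0 coeffs) fps \<Rightarrow> bool" where
  "supported A F \<longleftrightarrow> (\<forall>n. Poly_Mapping.keys (F $ n) \<subseteq> A)"

lemma supported_mult: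
  assumes "supported A F" "supported B G" "\<And>a b. a \<in> A \<Longrightarrow> b \<in> B \<Longrightarrow> a + b \<in> C"
  shows "supported C (F * G)"
  unfolding supported_def
proof (intro allI subsetI)
  fix n x assume "x \<in> Poly_Mapping.keys ((F * G) $ n)"
  then obtain i where "x \<in> Poly_Mapping.keys (F $ i * G $ (n - i))"
    by (auto simp: fps_mult_nth in_keys_iff lookup_sum elim!: sum.not_neutral_contains_not_neutral)
  then show "x \<in> C"
    using keys_mult[of "F $ i" "G $ (n - i)"] assms unfolding supported_def by blast
qed

lemma supported_sum:
  assumes "\<And>i. i \<in> I \<Longrightarrow> supported A (F i)"
  shows "supported A (\<Sum>i\<in>I. F i)"
  unfolding supported_def
proof (intro allI subsetI)
  fix n x assume "x \<in> Poly_Mapping.keys ((\<Sum>i\<in>I. F i) $ n)"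
  then obtain i where "i \<in> I" "x \<in> Poly_Mapping.keys (F i $ n)"
    by (auto simp: fps_sum_nth in_keys_iff lookup_sum elim!: sum.not_neutral_contains_not_neutral)
  then show "x \<in> A" using assms unfolding supported_def by blast
qed

lemma supported_scalar_lmonom: "supported {b} (scalar k * lmonom b)"
  by (auto simp: supported_def scalar_def lmonom_def mult_single split: if_splits)

lemma supported_prod:
  assumes "\<And>i. i \<in> I \<Longrightarrow> supported A (F i)" "0 \<in> A" "\<And>a b. a \<in> A \<Longrightarrow> b \<in> A \<Longrightarrow> a + b \<in> A"
  shows "supported A (\<Prod>i\<in>I. F i)"
  using assms(1)
proof (induction I rule: infinite_finite_induct)
  case (insert x F)
  then show ?case by (auto intro!: supported_mult[where A = A and B = A] assms(3))
qed (use assms(2) in \<open>auto simp: supported_def\<close>)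

lemma cf_outside_support: "supported A F \<Longrightarrow> w \<notin> A \<Longrightarrow> cf w F = 0"
  unfolding supported_def by (rule fps_ext) (simp add: cf_nth, meson in_keys_iff subsetD)

lemma keys_power_subset:
  fixes p :: "'b::comm_monoid_add \<Rightarrow>\<^sub>0 'r::comm_semiring_1"
  assumes "Poly_Mapping.keys p \<subseteq> A" "0 \<in> A" "\<And>a b. a \<in> A \<Longrightarrow> b \<in> A \<Longrightarrow> a + b \<in> A"
  shows "Poly_Mapping.keys (p ^ n) \<subseteq> A"
proof (induction n)
  case (Suc n)
  have "a + b \<in> A" if "a \<in> Poly_Mapping.keys p" "b \<in> Poly_Mapping.keys (p ^ n)" for a b
    using assms that Suc by blast
  then show ?case using keys_mult[of p "p ^ n"] by auto
qed (use assms(2) in \<open>simp add: keys_one\<close>)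

section \<open>Inverting a generic system of parameters\<close>

text \<open>\<open>co v\<close> is the coordinate at the vertex \<open>v\<close>, and
  \<open>H\<close> stands for the box points of height one. \<open>enc (v, h)\<close> numbers the
  variable y v h; the extra index \<open>0\<close>, which is no vertex, provides the variables of
  the generic linear form l.\<close>

locale theta_system =
  fixes V H :: "'b::real_vector set" and co :: "'b \<Rightarrow> 'b \<Rightarrow> real" and enc :: "'b \<times> 'b \<Rightarrow> nat"
  assumes finV: "finite V" and finH: "finite H"
    and additive: "v \<in> V \<Longrightarrow> co v (x + y) = co v x + co v y"
    and co_V: "v \<in> V \<Longrightarrow> w \<in> V \<Longrightarrow> co v w = (if v = w then 1 else 0)"
    and co_H: "v \<in> V \<Longrightarrow> h \<in> H \<Longrightarrow> co v h > 0"
    and disj: "V \<inter> H = {}"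
    and zeroV: "0 \<notin> V"
    and enc: "inj_on enc (insert 0 V \<times> H)"
begin

lemma co_0: "v \<in> V \<Longrightarrow> co v 0 = 0"
  using additive[of v 0 0] by simp

lemma co_minus: "v \<in> V \<Longrightarrow> co v (- x) = - co v x"
  using additive[of v x "- x"] co_0 by simp

definition expo :: "'b \<Rightarrow> 'b \<Rightarrow> nat \<Rightarrow>\<^sub>0 nat" where
  "expo v h = (if h = v then 0 else Poly_Mapping.single (enc (v, h)) 1)"

text \<open>The coefficient of x^h in \<open>theta v\<close> and, for \<open>v = 0\<close>, in the
  linear form l.\<close>

definition tau :: "'b \<Rightarrow> 'b \<Rightarrow> coeffs fps" where
  "tau v h = fps_X ^ (if h = v then 0 else 1) * fps_const (Poly_Mapping.single (expo v h) 1)"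

definition theta :: "'b \<Rightarrow> ('b \<Rightarrow>\<^sub>0 coeffs) fps" where
  "theta v = (\<Sum>h\<in>insert v H. scalar (tau v h) * lmonom h)"

definition pert :: "'b \<Rightarrow> 'b \<Rightarrow>\<^sub>0 coeffs" where
  "pert v = (\<Sum>h\<in>H. Poly_Mapping.single h (Poly_Mapping.single (expo v h) 1))"

text \<open>The geometric series for the inverse of x^v + \<epsilon> * \<open>pert v\<close>; the
  alternating signs disappear in characteristic two.\<close>

definition psi :: "'b \<Rightarrow> ('b \<Rightarrow>\<^sub>0 coeffs) fps" where
  "psi v = Abs_fps (\<lambda>n. Poly_Mapping.single (- v) 1 ^ Suc n * pert v ^ n)"

lemma fps_const_sum: "fps_const (\<Sum>i\<in>A. f i) = (\<Sum>i\<in>A. fps_const (f i))"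
  by (rule fps_ext) (simp add: fps_sum_nth sum.neutral)

lemma theta_eq:
  assumes "v \<in> V"
  shows "theta v = fps_const (Poly_Mapping.single v 1) + fps_X * fps_const (pert v)"
proof -
  have v: "v \<notin> H" using assms disj by auto
  have "tau v v = 1" by (simp add: tau_def expo_def)
  moreover have "scalar (tau v h) * lmonom h
      = fps_X * fps_const (Poly_Mapping.single h (Poly_Mapping.single (expo v h) 1))" if "h \<in> H" for h
  proof (rule fps_ext)
    fix n
    show "(scalar (tau v h) * lmonom h) $ n
      = (fps_X * fps_const (Poly_Mapping.single h (Poly_Mapping.single (expo v h) 1))) $ n"
      using that v by (cases n) (auto simp: scalar_def lmonom_def tau_def mult_single)
  qed
  ultimately have "theta v = lmonom v
      + (\<Sum>h\<in>H. fps_X * fps_const (Poly_Mapping.single h (Poly_Mapping.single (expo v h) 1)))"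
    using finH v by (simp add: theta_def)
  then show ?thesis
    by (simp add: lmonom_def pert_def sum_distrib_left fps_const_sum)
qed

lemma theta_psi:
  assumes "v \<in> V"
  shows "theta v * psi v = 1"
proof (rule fps_ext)
  fix n
  have inv: "Poly_Mapping.single v (1::coeffs) * Poly_Mapping.single (- v) 1 = 1"
    by (simp add: mult_single)
  show "(theta v * psi v) $ n = 1 $ n"
  proof (cases n)
    case 0
    then show ?thesis
      by (simp add: theta_eq[OF assms] psi_def distrib_right inv mult.assoc)
  next
    case (Suc m)
    have "(theta v * psi v) $ n = Poly_Mapping.single v 1 * (Poly_Mapping.single (- v) 1 ^ Suc n * pert v ^ n)
        + pert v * (Poly_Mapping.single (- v) 1 ^ Suc m * pert v ^ m)"
      by (simp add: theta_eq[OF assms] psi_def distrib_right Suc mult.assoc)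
    also have "\<dots> = Poly_Mapping.single v 1 * Poly_Mapping.single (- v) 1 * (Poly_Mapping.single (- v) 1 ^ n * pert v ^ n)
        + Poly_Mapping.single (- v) 1 ^ n * pert v ^ n"
      by (simp add: Suc algebra_simps)
    also have "\<dots> = 0"
      unfolding inv by (simp only: mult_1 char_two_double[OF laurent_char_two])
    finally show ?thesis by (simp add: Suc)
  qed
qed

definition Phi :: "('b \<Rightarrow>\<^sub>0 coeffs) fps" where
  "Phi = (\<Prod>v\<in>V. psi v)"

lemma prod_theta_Phi: "(\<Prod>v\<in>V. theta v) * Phi = 1"
  unfolding Phi_def prod.distrib[symmetric] using theta_psi by simp

lemma Phi_frobenius: "Phi = (\<Prod>v\<in>V. theta v) * Phi\<^sup>2"
  by (metis mult.assoc mult_1 power2_eq_square prod_theta_Phi)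

text \<open>Modulo \<epsilon> each \<open>theta v\<close> is the monomial x^v. This leading term is
  what allows the coefficients of a combination \<open>F\<close> to be recovered from
  \<open>F * Phi\<close>.\<close>

lemma Phi_nth_0: "Phi $ 0 = Poly_Mapping.single (- (\<Sum>v\<in>V. v)) 1"
proof -
  have "(\<Prod>v\<in>A. psi v) $ 0 = Poly_Mapping.single (- (\<Sum>v\<in>A. v)) 1" for A
    by (induction A rule: infinite_finite_induct) (simp_all add: psi_def mult_single)
  then show ?thesis by (simp add: Phi_def)
qed

text \<open>\<open>theta v\<close> cancels the factor \<open>psi v\<close>. The other factors only
  involve \<open>- w\<close> with \<open>w \<noteq> v\<close>, where \<open>co v\<close> is zero,
  and elements of \<open>H\<close>, where it is positive.\<close>

lemma theta_Phi_support:
  assumes v: "v \<in> V"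
  shows "supported {x. 0 \<le> co v x} (theta v * Phi)"
proof -
  have "theta v * Phi = theta v * psi v * (\<Prod>w\<in>V - {v}. psi w)"
    using v finV by (simp add: Phi_def prod.remove mult.assoc)
  also have "\<dots> = (\<Prod>w\<in>V - {v}. psi w)"
    using theta_psi[OF v] by simp
  finally have eq: "theta v * Phi = (\<Prod>w\<in>V - {v}. psi w)" .
  let ?A = "{x. 0 \<le> co v x}"
  have A: "0 \<in> ?A" "\<And>a b. a \<in> ?A \<Longrightarrow> b \<in> ?A \<Longrightarrow> a + b \<in> ?A"
    using additive[OF v] co_0[OF v] by auto
  have "supported ?A (psi w)" if "w \<in> V - {v}" for w
    unfolding supported_def
  proof
    fix n
    have "Poly_Mapping.keys (Poly_Mapping.single (- w) (1::coeffs)) \<subseteq> ?A"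
      using that v co_V[of v w] by (auto simp: co_minus)
    then have 1: "Poly_Mapping.keys (Poly_Mapping.single (- w) (1::coeffs) ^ Suc n) \<subseteq> ?A"
      by (rule keys_power_subset) (use A in auto)
    have "Poly_Mapping.keys (pert w) \<subseteq> H"
    proof
      fix x assume "x \<in> Poly_Mapping.keys (pert w)"
      then show "x \<in> H"
        unfolding pert_def in_keys_iff lookup_sum
        by (rule contrapos_np) (auto intro!: sum.neutral simp: lookup_single when_def)
    qed
    then have "Poly_Mapping.keys (pert w) \<subseteq> ?A"
      using co_H[OF v] by (force intro: less_imp_le)
    then have 2: "Poly_Mapping.keys (pert w ^ n) \<subseteq> ?A"
      by (rule keys_power_subset) (use A in auto)
    show "Poly_Mapping.keys (psi w $ n) \<subseteq> ?A"
    proof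
      fix x assume "x \<in> Poly_Mapping.keys (psi w $ n)"
      then obtain a b where "x = a + b" "a \<in> ?A" "b \<in> ?A"
        using keys_mult[of "Poly_Mapping.single (- w) (1::coeffs) ^ Suc n" "pert w ^ n"] 1 2
        unfolding psi_def fps_nth_Abs_fps by blast
      then show "x \<in> ?A" using A(2) by blast
    qed
  qed
  then show ?thesis
    unfolding eq by (intro supported_prod) (use A in auto)
qed

text \<open>Expanding \<open>Phi = (\<Prod>v\<in>V. theta v) * Phi\<^sup>2\<close> turns a coefficient of \<open>F\<^sup>2 * Phi\<close> into a combination of
  squares of coefficients of \<open>F * Phi\<close>, with distinct squarefree monomials as multipliers; so it can vanish
  only if all these coefficients do.\<close>

lemma cf_square_times_Phi:
  assumes zero: "cf 0 ((\<Sum>h\<in>H. scalar (tau 0 h) * lmonom h) * lmonom m * F\<^sup>2 * Phi) = 0"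
    and h: "h \<in> H" and p: "p \<in> V \<rightarrow>\<^sub>E H"
  shows "cf (- ((h + m + (\<Sum>v\<in>V. p v)) /\<^sub>R 2)) (F * Phi) = 0"
proof -
  let ?P = "\<Pi>\<^sub>E v\<in>V. insert v H"
  \<comment> \<open>A term of the expanded product is a choice of \<open>h\<close> from the linear
    form and of one exponent from every \<open>theta v\<close>; \<open>e\<close> and
    \<open>\<mu>\<close> are the powers of \<epsilon> and of the variables that it
    contributes.\<close>
  define Q where "Q = H \<times> ?P"
  define e :: "'b \<times> ('b \<Rightarrow> 'b) \<Rightarrow> nat"
    where "e q = (if fst q = 0 then 0 else 1) + (\<Sum>v\<in>V. if snd q v = v then 0 else 1)" for q
  define \<mu> where "\<mu> q = expo 0 (fst q) + (\<Sum>v\<in>V. expo v (snd q v))" for q :: "'b \<times> ('b \<Rightarrow> 'b)"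
  define f where "f q = cf (- ((fst q + m + (\<Sum>v\<in>V. snd q v)) /\<^sub>R 2)) (F * Phi)" for q
  have finP: "finite ?P" using finV finH by (intro finite_PiE) auto
  have finQ: "finite Q" unfolding Q_def using finP finH by simp
  have thetas: "(\<Prod>v\<in>V. theta v) = (\<Sum>p\<in>?P. scalar (\<Prod>v\<in>V. tau v (p v)) * lmonom (\<Sum>v\<in>V. p v))"
  proof -
    have "(\<Prod>v\<in>V. theta v) = (\<Sum>p\<in>?P. \<Prod>v\<in>V. scalar (tau v (p v)) * lmonom (p v))"
      unfolding theta_def by (rule prod_sum_PiE) (use finV finH in auto)
    then show ?thesis by (simp add: prod.distrib scalar_prod lmonom_sum)
  qed
  have tau_prod: "(\<Prod>v\<in>A. tau v (p v))
      = fps_X ^ (\<Sum>v\<in>A. if p v = v then 0 else 1) * fps_const (Poly_Mapping.single (\<Sum>v\<in>A. expo v (p v)) 1)" for p A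
  proof (induction A rule: infinite_finite_induct)
    case (insert a A)
    have "Poly_Mapping.single (expo a (p a) + (\<Sum>v\<in>A. expo v (p v))) (1::bit)
        = Poly_Mapping.single (expo a (p a)) 1 * Poly_Mapping.single (\<Sum>v\<in>A. expo v (p v)) 1"
      by (simp add: mult_single)
    then show ?case using insert
      by (simp add: tau_def power_add fps_const_mult[symmetric] del: fps_const_mult)
  qed simp_all
  have "(\<Sum>h\<in>H. scalar (tau 0 h) * lmonom h) * lmonom m * F\<^sup>2 * Phi
      = (\<Sum>h\<in>H. scalar (tau 0 h) * lmonom h) * (\<Prod>v\<in>V. theta v) * (lmonom m * (F * Phi)\<^sup>2)"
    by (subst Phi_frobenius) (simp add: power_mult_distrib mult_ac)
  also have "\<dots> = (\<Sum>q\<in>Q. (scalar (tau 0 (fst q)) * lmonom (fst q)) *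
      (scalar (\<Prod>v\<in>V. tau v (snd q v)) * lmonom (\<Sum>v\<in>V. snd q v)) * (lmonom m * (F * Phi)\<^sup>2))"
    unfolding thetas sum_product sum.cartesian_product Q_def
    by (simp add: sum_distrib_right case_prod_beta)
  also have "\<dots> = (\<Sum>q\<in>Q. scalar (tau 0 (fst q) * (\<Prod>v\<in>V. tau v (snd q v))) *
      (lmonom (fst q + m + (\<Sum>v\<in>V. snd q v)) * (F * Phi)\<^sup>2))"
    by (intro sum.cong refl) (simp only: scalar_mult lmonom_add mult_ac)
  finally have "0 = (\<Sum>q\<in>Q. tau 0 (fst q) * (\<Prod>v\<in>V. tau v (snd q v)) * (f q)\<^sup>2)"
    using zero by (simp only: cf_sum cf_scalar_mult cf_lmonom_mult cf_square f_def diff_0 scaleR_minus_right)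
  also have "\<dots> = (\<Sum>q\<in>Q. fps_X ^ e q * fps_const (Poly_Mapping.single (\<mu> q) 1) * (f q)\<^sup>2)"
  proof (intro sum.cong refl)
    fix q assume "q \<in> Q"
    have "Poly_Mapping.single (\<mu> q) (1::bit)
        = Poly_Mapping.single (expo 0 (fst q)) 1 * Poly_Mapping.single (\<Sum>v\<in>V. expo v (snd q v)) 1"
      by (simp add: \<mu>_def mult_single)
    then have "tau 0 (fst q) * (\<Prod>v\<in>V. tau v (snd q v)) = fps_X ^ e q * fps_const (Poly_Mapping.single (\<mu> q) 1)"
      unfolding tau_prod e_def
      by (simp add: tau_def power_add fps_const_mult[symmetric] mult_ac del: fps_const_mult)
    then show "tau 0 (fst q) * (\<Prod>v\<in>V. tau v (snd q v)) * (f q)\<^sup>2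
        = fps_X ^ e q * fps_const (Poly_Mapping.single (\<mu> q) 1) * (f q)\<^sup>2" by simp
  qed
  finally have sum0: "(\<Sum>q\<in>Q. fps_X ^ e q * fps_const (Poly_Mapping.single (\<mu> q) 1) * (f q)\<^sup>2) = 0" ..
  \<comment> \<open>Both choices are merged into one function on \<open>insert 0 V\<close>, with
    \<open>0\<close> standing for the linear form. A variable appears exactly where this function
    differs from the identity.\<close>
  define g where "g q v = (if v = 0 then fst q else snd q v)" for q :: "'b \<times> ('b \<Rightarrow> 'b)" and v
  let ?S = "\<lambda>q i. {v\<in>insert 0 V. g q v \<noteq> v \<and> enc (v, g q v) = i}"
  have \<mu>: "Poly_Mapping.lookup (\<mu> q) i = card (?S q i)" for q i
  proof -
    have "\<mu> q = (\<Sum>v\<in>insert 0 V. expo v (g q v))"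
    proof -
      have "(\<Sum>v\<in>V. expo v (g q v)) = (\<Sum>v\<in>V. expo v (snd q v))"
        by (rule sum.cong) (use zeroV in \<open>auto simp: g_def\<close>)
      then show ?thesis using finV zeroV by (simp add: \<mu>_def) (simp add: g_def)
    qed
    then have "Poly_Mapping.lookup (\<mu> q) i = (\<Sum>v\<in>insert 0 V. if g q v \<noteq> v \<and> enc (v, g q v) = i then 1 else 0)"
      by (simp only: lookup_sum expo_def) (intro sum.cong refl, simp add: lookup_single when_def)
    also have "\<dots> = card (?S q i)"
      using finV by (simp add: sum.If_cases Int_def)
    finally show ?thesis .
  qed
  have mem: "g q v \<in> H" if "q \<in> Q" "v \<in> insert 0 V" "g q v \<noteq> v" for q v
    using that zeroV unfolding g_def Q_def by (auto split: if_splits dest: PiE_mem)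
  have uniq: "v = w" if "q \<in> Q" "v \<in> ?S q i" "w \<in> ?S q i" for q v w i
    using that mem[OF that(1), of v] mem[OF that(1), of w] inj_onD[OF enc, of "(v, g q v)" "(w, g q w)"] by auto
  have sqfree: "Poly_Mapping.lookup (\<mu> q) i \<le> 1" if "q \<in> Q" for q i
  proof -
    have "finite (?S q i)" using finV by simp
    then show ?thesis
      unfolding \<mu> using uniq[OF that] by (simp only: One_nat_def card_le_Suc0_iff_eq) blast
  qed
  \<comment> \<open>The variable of \<open>(v, g q v)\<close> also occurs in
    \<open>\<mu> q'\<close>, and \<open>enc\<close> is injective, so \<open>q'\<close> makes the
    same choice at \<open>v\<close>. Choices without a variable are settled by symmetry.\<close>
  have g_eq: "g q v = g q' v"
    if "q \<in> Q" "q' \<in> Q" "\<mu> q = \<mu> q'" "v \<in> insert 0 V" "g q v \<noteq> v" for q q' v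
  proof -
    have "v \<in> ?S q (enc (v, g q v))" using that by simp
    moreover have "finite (?S q (enc (v, g q v)))" using finV by simp
    ultimately have "card (?S q (enc (v, g q v))) > 0" unfolding card_gt_0_iff by blast
    then have "card (?S q' (enc (v, g q v))) > 0" using \<mu>[of q] \<mu>[of q'] that(3) by simp
    then have "?S q' (enc (v, g q v)) \<noteq> {}" unfolding card_gt_0_iff by blast
    then obtain w where w: "w \<in> ?S q' (enc (v, g q v))" by blast
    then have "(v, g q v) = (w, g q' w)"
      using inj_onD[OF enc, of "(v, g q v)" "(w, g q' w)"] mem[OF that(1,4,5)] mem[OF that(2), of w] that(4) by auto
    then show ?thesis by blast
  qed
  have "inj_on \<mu> Q"
  proof (rule inj_onI)
    fix q q' assume q: "q \<in> Q" "q' \<in> Q" "\<mu> q = \<mu> q'"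
    have g: "g q v = g q' v" if "v \<in> insert 0 V" for v
      using g_eq[OF q that] g_eq[OF q(2,1) q(3)[symmetric] that] by metis
    have "fst q = fst q'" using g[of 0] by (simp add: g_def)
    moreover have "snd q = snd q'"
    proof (rule PiE_ext[of _ V "\<lambda>v. insert v H"])
      show "snd q v = snd q' v" if "v \<in> V" for v
        using g[of v] that zeroV by (auto simp: g_def split: if_splits)
    qed (use q in \<open>auto simp: Q_def\<close>)
    ultimately show "q = q'" by (rule prod_eqI)
  qed
  moreover have "(h, p) \<in> Q" using h p unfolding Q_def by (auto simp: PiE_iff)
  ultimately have "f (h, p) = 0"
    using squarefree_monomials_independent[of Q \<mu> e f "(h, p)"] finQ sqfree sum0 by blast
  then show ?thesis by (simp add: f_def)
qed

end

section \<open>Box points of a simplicial cone\<close>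

text \<open>The lattice points of height \<open>n\<close> in the cone. For the cone over a simplex
  they correspond to the lattice points of its \<open>n\<close>-th dilate.\<close>

definition slice :: "'b set \<Rightarrow> 'b set \<Rightarrow> ('b \<Rightarrow> 'b \<Rightarrow> real) \<Rightarrow> nat \<Rightarrow> 'b set" where
  "slice V L co n = {x \<in> L. (\<forall>v\<in>V. 0 \<le> co v x) \<and> (\<Sum>v\<in>V. co v x) = real n}"

locale simplicial_cone =
  fixes V L :: "'b::real_vector set" and co :: "'b \<Rightarrow> 'b \<Rightarrow> real"
  assumes finV: "finite V" and V_nonempty: "V \<noteq> {}" and VL: "V \<subseteq> L"
    and zero_L: "0 \<in> L"
    and diff_L: "x \<in> L \<Longrightarrow> y \<in> L \<Longrightarrow> x - y \<in> L"
    and lin: "v \<in> V \<Longrightarrow> linear (co v)"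
    and co_V: "v \<in> V \<Longrightarrow> w \<in> V \<Longrightarrow> co v w = (if v = w then 1 else 0)"
    and expand: "x \<in> L \<Longrightarrow> x = (\<Sum>v\<in>V. co v x *\<^sub>R v)"
    and height_int: "x \<in> L \<Longrightarrow> (\<Sum>v\<in>V. co v x) \<in> \<int>"
    and fin_slice: "finite (slice V L co n)"
begin

abbreviation S :: "nat \<Rightarrow> 'b set" where "S \<equiv> slice V L co"

text \<open>The box points of height \<open>n\<close>; by \<open>ehrhart_numerator\<close> their
  numbers are the coefficients of the h*-polynomial.\<close>

definition pbox :: "nat \<Rightarrow> 'b set" where
  "pbox n = {x \<in> S n. \<forall>v\<in>V. co v x < 1}"

lemma co_add: "v \<in> V \<Longrightarrow> co v (x + y) = co v x + co v y"
  and co_diff: "v \<in> V \<Longrightarrow> co v (x - y) = co v x - co v y"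
  and co_minus: "v \<in> V \<Longrightarrow> co v (- x) = - co v x"
  and co_zero: "v \<in> V \<Longrightarrow> co v 0 = 0"
  and co_sum: "v \<in> V \<Longrightarrow> co v (sum f A) = (\<Sum>a\<in>A. co v (f a))"
  and co_scale: "v \<in> V \<Longrightarrow> co v (c *\<^sub>R x) = c * co v x"
  using lin by (auto simp: linear_add linear_diff linear_neg linear_0 linear_sum linear_scale)

lemma add_L: "x \<in> L \<Longrightarrow> y \<in> L \<Longrightarrow> x + y \<in> L"
  using diff_L[of x "0 - y"] diff_L[OF zero_L, of y] by simp

lemma sum_L: "(\<And>a. a \<in> A \<Longrightarrow> f a \<in> L) \<Longrightarrow> sum f A \<in> L"
  by (induction A rule: infinite_finite_induct) (auto simp: zero_L intro: add_L)

lemma scale_L: "x \<in> L \<Longrightarrow> real n *\<^sub>R x \<in> L"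
  using sum_L[of "{..<n}" "\<lambda>_. x"] by (simp add: scaleR_conv_of_real sum_constant_scaleR)

lemma co_sum_V: "v \<in> V \<Longrightarrow> co v (\<Sum>w\<in>V. w) = 1"
  using finV by (simp add: co_sum co_V)

lemma V_slice: "V \<subseteq> S 1"
  using VL finV by (auto simp: slice_def co_V)

lemma zero_slice: "0 \<in> S 0"
  by (simp add: slice_def zero_L co_zero)

lemma add_slice: "x \<in> S m \<Longrightarrow> y \<in> S n \<Longrightarrow> x + y \<in> S (m + n)"
  by (auto simp: slice_def add_L co_add sum.distrib)

lemma sum_slice: "finite A \<Longrightarrow> (\<And>a. a \<in> A \<Longrightarrow> f a \<in> S 1) \<Longrightarrow> sum f A \<in> S (card A)"
proof (induction A rule: finite_induct)
  case (insert a A)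
  then show ?case using add_slice[of "f a" 1 "sum f A" "card A"] by simp
qed (simp add: zero_slice)

lemma slice_remove:
  assumes "x \<in> S n" "v \<in> V" "1 \<le> co v x"
  shows "1 \<le> n" "x - v \<in> S (n - 1)"
proof -
  have "co v x \<le> (\<Sum>w\<in>V. co w x)"
    using assms finV by (intro member_le_sum) (auto simp: slice_def)
  then have "1 \<le> real n" using assms by (simp add: slice_def)
  then show "1 \<le> n" by simp
  then show "x - v \<in> S (n - 1)"
    using assms VL finV by (auto simp: slice_def diff_L co_diff co_V sum_subtractf of_nat_diff)
qed

text \<open>The generators are treated one at a time. Subtracting \<open>v\<close> matches the
  points of height \<open>n + 1\<close> with \<open>v\<close>-coordinate at least one with the
  points of height \<open>n\<close>, so each factor \<open>1 - fps_X\<close> forces one more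
  coordinate below one.\<close>

lemma ehrhart_numerator:
  "Abs_fps (\<lambda>n. real (card (S n))) * (1 - fps_X) ^ card V = Abs_fps (\<lambda>n. real (card (pbox n)))"
proof -
  let ?S = "\<lambda>T n. {x \<in> S n. \<forall>v\<in>T. co v x < 1}"
  have "Abs_fps (\<lambda>n. real (card (S n))) * (1 - fps_X) ^ card T = Abs_fps (\<lambda>n. real (card (?S T n)))"
    if "T \<subseteq> V" for T
    using finite_subset[OF that finV] that
  proof (induction T rule: finite_induct)
    case (insert v T)
    have v: "v \<in> V" "T \<subseteq> V" using insert by auto
    have fin: "finite (?S U n)" for U n using fin_slice[of n] by simp
    have split: "?S T n = ?S (insert v T) n \<union> {x \<in> ?S T n. 1 \<le> co v x}"
      "?S (insert v T) n \<inter> {x \<in> ?S T n. 1 \<le> co v x} = {}" for n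
      by auto
    have card: "card (?S T n) = card (?S (insert v T) n) + card {x \<in> ?S T n. 1 \<le> co v x}" for n
      by (subst split(1)[of n], rule card_Un_disjoint) (use fin_slice[of n] in auto)
    have upper: "{x \<in> ?S T (Suc n). 1 \<le> co v x} = (\<lambda>x. x + v) ` ?S T n" for n
    proof (intro equalityI subsetI)
      fix x assume x: "x \<in> {x \<in> ?S T (Suc n). 1 \<le> co v x}"
      have "x - v \<in> S n" using slice_remove(2)[of x "Suc n" v] x v by simp
      moreover have "co w (x - v) < 1" if "w \<in> T" for w
        using x that v insert.hyps by (auto simp: co_diff co_V subset_iff)
      ultimately have "x - v \<in> ?S T n" by simp
      then show "x \<in> (\<lambda>x. x + v) ` ?S T n" by (rule rev_image_eqI) simp
    next
      fix y assume "y \<in> (\<lambda>x. x + v) ` ?S T n"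
      then obtain x where x: "x \<in> ?S T n" "y = x + v" by blast
      have "x + v \<in> S (Suc n)" using add_slice[of x n v 1] x V_slice v by auto
      moreover have "co w (x + v) < 1" if "w \<in> T" for w
        using x that v insert.hyps by (auto simp: co_add co_V subset_iff)
      moreover have "1 \<le> co v (x + v)" using x v by (auto simp: co_add co_V slice_def)
      ultimately show "y \<in> {x \<in> ?S T (Suc n). 1 \<le> co v x}" using x by simp
    qed
    have zero: "{x \<in> ?S T 0. 1 \<le> co v x} = {}"
      using slice_remove(1)[of _ 0 v] v by auto
    have "Abs_fps (\<lambda>n. real (card (?S (insert v T) n))) = Abs_fps (\<lambda>n. real (card (?S T n))) * (1 - fps_X)"
    proof (rule fps_ext)
      fix n
      show "Abs_fps (\<lambda>n. real (card (?S (insert v T) n))) $ n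
          = (Abs_fps (\<lambda>n. real (card (?S T n))) * (1 - fps_X)) $ n"
      proof (cases n)
        case 0
        then show ?thesis using card[of 0] unfolding zero by (simp add: algebra_simps)
      next
        case (Suc m)
        have "card {x \<in> ?S T (Suc m). 1 \<le> co v x} = card (?S T m)"
          unfolding upper by (rule card_image) simp
        then show ?thesis using card[of "Suc m"] Suc by (simp add: algebra_simps)
      qed
    qed
    moreover have "Abs_fps (\<lambda>n. real (card (S n))) * (1 - fps_X) ^ card T = Abs_fps (\<lambda>n. real (card (?S T n)))"
      using insert by simp
    ultimately show ?case using insert by (simp add: mult_ac)
  qed simp
  from this[of V] show ?thesis by (simp add: pbox_def)
qed

lemma fin_pbox: "finite (pbox n)"
  using fin_slice[of n] by (simp add: pbox_def)

lemma pbox_empty: "card V \<le> n \<Longrightarrow> pbox n = {}"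
proof (rule ccontr)
  assume n: "card V \<le> n" and "pbox n \<noteq> {}"
  then obtain x where "x \<in> S n" "\<forall>v\<in>V. co v x < 1" by (auto simp: pbox_def)
  then have "real n < (\<Sum>v\<in>V. 1)"
    using sum_strict_mono[OF finV V_nonempty, of "\<lambda>v. co v x" "\<lambda>_. 1"] by (simp add: slice_def)
  with n show False by simp
qed

lemma pbox_zero: "pbox 0 = {0}"
proof -
  have "x = 0" if "x \<in> S 0" for x
  proof -
    have "\<forall>v\<in>V. co v x = 0"
      using that finV sum_nonneg_eq_0_iff[of V "\<lambda>v. co v x"] by (simp add: slice_def)
    then show ?thesis using expand[of x] that by (simp add: slice_def)
  qed
  then show ?thesis using zero_slice by (auto simp: pbox_def co_zero)
qed

end

section \<open>Cones over clean simplices with integer decomposition\<close>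

locale clean_idp_cone = simplicial_cone +
  assumes idp: "x \<in> S n \<Longrightarrow> \<exists>y. (\<forall>i<n. y i \<in> S 1) \<and> x = (\<Sum>i<n. y i)"
    and clean: "x \<in> S 1 \<Longrightarrow> v \<in> V \<Longrightarrow> co v x = 0 \<Longrightarrow> x \<in> V"
begin

text \<open>The summands have nonnegative \<open>v\<close>-coordinates adding up to zero, so all lie
  on the face opposite \<open>v\<close>, where cleanness leaves only vertices.\<close>

lemma face_decomposition:
  assumes "x \<in> S n" "v \<in> V" "co v x = 0"
  obtains y where "\<And>i. i < n \<Longrightarrow> y i \<in> V" "x = (\<Sum>i<n. y i)"
proof -
  obtain y where y: "\<forall>i<n. y i \<in> S 1" "x = (\<Sum>i<n. y i)"
    using idp[OF assms(1)] by blast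
  then have "(\<Sum>i<n. co v (y i)) = 0" using assms by (simp add: co_sum)
  then have "\<forall>i<n. co v (y i) = 0"
    using sum_nonneg_eq_0_iff[of "{..<n}" "\<lambda>i. co v (y i)"] y(1) assms(2) by (auto simp: slice_def)
  then show thesis using that y clean[OF _ assms(2)] by blast
qed

text \<open>A lattice point in the span of a facet is moved into the cone by adding a large multiple
  of each vertex of the facet, and there it is a sum of vertices. So the vertices generate the
  lattice of the facet, which is what makes facets unimodular.\<close>

lemma face_integral:
  assumes x: "x \<in> L" and v: "v \<in> V" "co v x = 0" and w: "w \<in> V"
  shows "co w x \<in> \<int>"
proof -
  obtain N :: nat where N: "(\<Sum>u\<in>V. \<bar>co u x\<bar>) \<le> real N" using real_arch_simple by blast
  define z where "z = x + (\<Sum>u\<in>V - {v}. real N *\<^sub>R u)"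
  have co_z: "co u z = co u x + (if u = v then 0 else real N)" if "u \<in> V" for u
    using that finV by (simp add: z_def co_add co_sum co_scale co_V if_distrib sum.If_cases
        Int_def cong: if_cong)
  have z: "z \<in> L" unfolding z_def using VL by (intro add_L x sum_L scale_L) auto
  have pos: "0 \<le> co u z" if "u \<in> V" for u
  proof -
    have "\<bar>co u x\<bar> \<le> (\<Sum>u\<in>V. \<bar>co u x\<bar>)" using that finV by (intro member_le_sum) auto
    then show ?thesis using that v N by (auto simp: co_z)
  qed
  have "(\<Sum>u\<in>V. co u z) \<in> \<int>" by (rule height_int[OF z])
  moreover have "0 \<le> (\<Sum>u\<in>V. co u z)" by (intro sum_nonneg pos)
  ultimately obtain n where n: "(\<Sum>u\<in>V. co u z) = real n"
    by (metis Ints_cases of_int_0_le_iff of_int_of_nat_eq zero_le_imp_eq_int)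
  then have "z \<in> S n" using z pos by (simp add: slice_def)
  moreover have "co v z = 0" using v by (simp add: co_z)
  ultimately obtain y where y: "\<And>i. i < n \<Longrightarrow> y i \<in> V" "z = (\<Sum>i<n. y i)"
    using face_decomposition v(1) by metis
  have "co w z = (\<Sum>i<n. co w (y i))" unfolding y(2) by (rule co_sum[OF w])
  also have "\<dots> \<in> \<int>" using y(1) w by (intro Ints_sum) (auto simp: co_V)
  finally show ?thesis using w by (auto simp: co_z split: if_splits)
qed

text \<open>A box point on a facet would be a sum of \<open>n \<ge> 1\<close> vertices and so have a
  coordinate of at least one.\<close>

lemma pbox_pos:
  assumes "x \<in> pbox n" "1 \<le> n" "v \<in> V"
  shows "0 < co v x"
proof (rule ccontr)
  assume "\<not> 0 < co v x"
  then have "co v x = 0" "x \<in> S n" using assms by (force simp: pbox_def slice_def)+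
  then obtain y where y: "\<And>i. i < n \<Longrightarrow> y i \<in> V" "x = (\<Sum>i<n. y i)"
    using face_decomposition assms(3) by metis
  have "co (y 0) (y 0) \<le> (\<Sum>i<n. co (y 0) (y i))"
    using y(1) assms(2) by (intro member_le_sum) (auto simp: co_V)
  also have "\<dots> = co (y 0) x" using y assms(2) by (simp add: co_sum)
  also have "\<dots> < 1" using assms y(1) by (simp add: pbox_def)
  finally show False using y(1) assms(2) by (simp add: co_V)
qed

lemma pbox_compl:
  assumes "x \<in> pbox n" "1 \<le> n"
  shows "(\<Sum>v\<in>V. v) - x \<in> pbox (card V - n)"
proof -
  have n: "n < card V" using pbox_empty[of n] assms by (cases "n < card V") auto
  have "(\<Sum>v\<in>V. v) - x \<in> L"
    using assms VL by (intro diff_L sum_L) (auto simp: pbox_def slice_def)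
  then show ?thesis
    using assms pbox_pos[OF assms] n
    by (auto simp: pbox_def slice_def co_diff co_sum_V sum_subtractf of_nat_diff less_imp_le)
qed

lemma card_pbox_compl:
  assumes "1 \<le> n" "n < card V"
  shows "card (pbox (card V - n)) = card (pbox n)"
proof -
  have "card (pbox m) \<le> card (pbox (card V - m))" if "1 \<le> m" for m
  proof (rule card_inj_on_le[OF _ _ fin_pbox])
    show "inj_on (\<lambda>x. (\<Sum>v\<in>V. v) - x) (pbox m)" by (rule inj_onI) simp
  qed (use pbox_compl that in auto)
  from this[of n] this[of "card V - n"] show ?thesis using assms by simp
qed

text \<open>Each coordinate of a summand is at most that of the sum, hence below one, so the
  summands stay in the box.\<close>

lemma pbox_decomposition:
  assumes "x \<in> pbox n"
  obtains y where "\<And>i. i < n \<Longrightarrow> y i \<in> pbox 1" "x = (\<Sum>i<n. y i)"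
proof -
  obtain y where y: "\<forall>i<n. y i \<in> S 1" "x = (\<Sum>i<n. y i)"
    using idp[of x n] assms by (auto simp: pbox_def)
  have "co v (y i) < 1" if "i < n" "v \<in> V" for i v
  proof -
    have "co v (y i) \<le> (\<Sum>i<n. co v (y i))"
      using y(1) that by (intro member_le_sum) (auto simp: slice_def)
    also have "\<dots> < 1" using assms that by (simp add: y(2) co_sum pbox_def)
    finally show ?thesis .
  qed
  then show thesis using y by (intro that[of y]) (auto simp: pbox_def)
qed

lemma pbox_1_empty: "pbox 1 = {} \<Longrightarrow> 1 \<le> n \<Longrightarrow> pbox n = {}"
  using pbox_decomposition[of _ n] by (metis all_not_in_conv less_le_trans zero_less_one)

end

section \<open>Growth of the box point counts below the middle height\<close>

lemma supported_mono: "supported A F \<Longrightarrow> A \<subseteq> B \<Longrightarrow> supported B F"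
  unfolding supported_def by blast

context clean_idp_cone
begin

theorem card_pbox_le:
  assumes n: "1 \<le> n" "2 * n < card V"
  shows "card (pbox n) \<le> card (pbox (Suc n))"
proof (rule ccontr)
  assume contr: "\<not> card (pbox n) \<le> card (pbox (Suc n))"
  define D where "D = card V"
  define H where "H = pbox 1"
  have finH: "finite H" by (simp add: H_def fin_pbox)
  have zeroV: "0 \<notin> V" using co_V[of 0 0] co_zero[of 0] by auto
  have disj: "V \<inter> H = {}" using co_V by (fastforce simp: H_def pbox_def)
  obtain enc :: "_ \<Rightarrow> nat" where enc: "inj_on enc (insert 0 V \<times> H)"
    using finite_imp_inj_to_nat_seg[of "insert 0 V \<times> H"] finV finH by auto
  interpret theta_system V H co enc
    by unfold_locales (use finV finH disj zeroV enc co_add co_V pbox_pos in \<open>auto simp: H_def\<close>)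
  have H_slice: "H \<subseteq> S 1" by (auto simp: H_def pbox_def)
  define ell where "ell = (\<Sum>h\<in>H. scalar (tau 0 h) * lmonom h)"
  define I where "I = pbox n"
  \<comment> \<open>By complementation \<open>J\<close> has as many elements as
    \<open>pbox (Suc n)\<close>, so the assumption leaves fewer equations, one for each
    \<open>w \<in> J\<close>, than unknowns \<open>u g\<close>.\<close>
  define J where "J = pbox (D - n - 1)"
  have "card J = card (pbox (Suc n))"
    using card_pbox_compl[of "Suc n"] n by (simp add: J_def D_def)
  then have "card J < card I" using contr by (simp add: I_def)
  then obtain u where u: "\<exists>g\<in>I. u g \<noteq> 0"
    "\<And>w. w \<in> J \<Longrightarrow> (\<Sum>g\<in>I. cf (- w) (lmonom g * ell * Phi) * u g) = 0"
    using underdetermined_linear_system[of J I "\<lambda>w g. cf (- w) (lmonom g * ell * Phi)"]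
    by (auto simp: I_def J_def fin_pbox)
  define F where "F = (\<Sum>g\<in>I. scalar (u g) * lmonom g)"
  define G where "G = F * ell * Phi"
  have GJ: "cf (- w) G = 0" if "w \<in> J" for w
  proof -
    have "G = (\<Sum>g\<in>I. scalar (u g) * (lmonom g * ell * Phi))"
      by (simp add: G_def F_def sum_distrib_right mult.assoc)
    then have "cf (- w) G = (\<Sum>g\<in>I. cf (- w) (lmonom g * ell * Phi) * u g)"
      by (simp add: cf_sum cf_scalar_mult mult.commute)
    then show ?thesis using u(2)[OF that] by simp
  qed
  have slice_add_H: "w + h \<in> S (Suc k)" if "w \<in> S k" "h \<in> H" for w h k
    using add_slice[of w k h 1] that H_slice by auto
  \<comment> \<open>All exponents of \<open>theta v * G\<close> have positive
    \<open>v\<close>-coordinate: \<open>F\<close> and \<open>ell\<close> contribute interior points,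
    and \<open>theta v * Phi\<close> nothing negative. The exponent \<open>- w\<close> is not of
    this kind.\<close>
  have theta_G: "cf (- w) (theta v * G) = 0" if v: "v \<in> V" and w: "w \<in> S k" for v w k
  proof -
    let ?P = "{x. 0 < co v x}"
    have "supported ?P F"
      unfolding F_def
      by (intro supported_sum supported_mono[OF supported_scalar_lmonom])
        (use pbox_pos v n in \<open>auto simp: I_def\<close>)
    moreover have "supported ?P ell"
      unfolding ell_def
      by (intro supported_sum supported_mono[OF supported_scalar_lmonom])
        (use pbox_pos v in \<open>auto simp: H_def\<close>)
    ultimately have "supported ?P (F * ell)"
      by (rule supported_mult) (use v in \<open>auto simp: co_add\<close>)
    then have "supported ?P (F * ell * (theta v * Phi))"
      by (rule supported_mult[OF _ theta_Phi_support[OF v]]) (use v in \<open>auto simp: co_add\<close>)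
    then have "supported ?P (theta v * G)" by (simp add: G_def mult_ac)
    then show ?thesis
      by (rule cf_outside_support) (use v w in \<open>auto simp: slice_def co_minus\<close>)
  qed
  \<comment> \<open>Vanishing spreads from \<open>J\<close> to all lattice points of this height, by
    induction on the order \<open>N\<close> in \<epsilon>. Outside the box some \<open>v\<close>
    splits off from \<open>w\<close>, and the vanishing coefficient of \<open>theta v * G\<close> at
    \<open>- (w - v)\<close> trades x^v for terms x^h that carry a factor \<epsilon>, hence involve
    \<open>G\<close> in lower order.\<close>
  have "\<forall>w\<in>S (D - n - 1). cf (- w) G $ N = 0" for N
  proof (induction N rule: less_induct)
    case (less N)
    show ?case
    proof
      fix w assume w: "w \<in> S (D - n - 1)"
      show "cf (- w) G $ N = 0"
      proof (cases "w \<in> J")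
        case False
        then obtain v where v: "v \<in> V" "1 \<le> co v w"
          using w by (force simp: J_def pbox_def)
        define w' where "w' = w - v"
        have w': "w' \<in> S (D - n - 1 - 1)" "D - n - 1 = Suc (D - n - 1 - 1)"
          using slice_remove[OF w v] by (auto simp: w'_def)
        have "v \<notin> H" using v disj by auto
        then have "cf (- w') (theta v * G) = tau v v * cf (- w' - v) G + (\<Sum>h\<in>H. tau v h * cf (- w' - h) G)"
          using finH by (simp add: theta_def sum_distrib_right cf_sum mult.assoc cf_scalar_mult cf_lmonom_mult
              cf_add distrib_right)
        moreover have "tau v v = 1" by (simp add: tau_def expo_def)
        moreover have "- w' - v = - w" by (simp add: w'_def)
        ultimately have "cf (- w) G + (\<Sum>h\<in>H. tau v h * cf (- w' - h) G) = 0"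
          using theta_G[OF v(1) w'(1)] by simp
        then have "(cf (- w) G + (\<Sum>h\<in>H. tau v h * cf (- w' - h) G)) $ N = 0" by simp
        then have "cf (- w) G $ N + (\<Sum>h\<in>H. (tau v h * cf (- w' - h) G) $ N) = 0"
          by (simp only: fps_add_nth fps_sum_nth)
        moreover have "(tau v h * cf (- w' - h) G) $ N = 0" if "h \<in> H" for h
        proof (cases N)
          case 0
          then show ?thesis using that \<open>v \<notin> H\<close> by (auto simp: tau_def mult.assoc)
        next
          case (Suc N')
          have "w' + h \<in> S (D - n - 1)" using slice_add_H[OF w'(1) that] w'(2) by simp
          then have "cf (- (w' + h)) G $ N' = 0" using less Suc by blast
          then have "cf (- w' - h) G $ N' = 0" by simp
          then show ?thesis using that \<open>v \<notin> H\<close> Suc by (auto simp: tau_def mult.assoc)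
        qed
        ultimately show ?thesis by simp
      qed (simp add: GJ)
    qed
  qed
  then have GS: "cf (- w) G = 0" if "w \<in> S (D - n - 1)" for w
    using that by (intro fps_ext) simp
  have FPhi: "cf (- w) (F * Phi) = 0" if w: "w \<in> pbox (D - n)" for w
  proof -
    \<comment> \<open>Listing the \<open>k\<close> summands of \<open>w\<close> twice gives
      \<open>2 * k > D\<close> elements of \<open>H\<close> with sum \<open>2 *\<^sub>R w\<close>.
      They are dealt out as one for each vertex, one (of index \<open>D\<close>) for
      \<open>ell\<close>, and the remaining \<open>D - 2 * n - 1\<close> for
      \<open>m\<close>.\<close>
    define k where "k = D - n"
    have k: "D < 2 * k" "n < k" using n by (auto simp: k_def D_def)
    obtain y where y: "\<And>i. i < k \<Longrightarrow> y i \<in> H" "w = (\<Sum>i<k. y i)"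
      using pbox_decomposition[OF w] unfolding k_def H_def by metis
    define z where "z i = y (i mod k)" for i
    have z: "z i \<in> H" for i using y k by (simp add: z_def)
    have sum_z: "(\<Sum>i<2*k. z i) = w + w"
    proof -
      have "{..<2*k} = {..<k} \<union> {k..<2*k}" by auto
      then have "(\<Sum>i<2*k. z i) = (\<Sum>i<k. z i) + (\<Sum>i\<in>{k..<2*k}. z i)"
        by (simp add: sum.union_disjoint ivl_disj_int)
      also have "(\<Sum>i\<in>{k..<2*k}. z i) = (\<Sum>i<k. z i)"
        by (rule sum.reindex_bij_witness[where i = "\<lambda>i. i + k" and j = "\<lambda>i. i - k"])
          (auto simp: z_def mod_if)
      also have "(\<Sum>i<k. z i) = w" by (simp add: z_def y(2))
      finally show ?thesis .
    qed
    obtain b where b: "bij_betw b V {..<D}"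
      using ex_bij_betw_finite_nat[OF finV] unfolding D_def atLeast0LessThan by blast
    define p where "p = restrict (\<lambda>v. z (b v)) V"
    define m where "m = (\<Sum>i\<in>{D<..<2*k}. z i)"
    have p: "p \<in> V \<rightarrow>\<^sub>E H" using z by (auto simp: p_def)
    have sum_p: "(\<Sum>v\<in>V. p v) = (\<Sum>i<D. z i)"
      using sum.reindex_bij_betw[OF b, of z] by (simp add: p_def)
    have "w + w = sum z {..<2*k}" by (rule sum_z[symmetric])
    also have "{..<2*k} = {..<D} \<union> insert D {D<..<2*k}" using k by auto
    also have "sum z \<dots> = sum z {..<D} + sum z (insert D {D<..<2*k})"
      by (rule sum.union_disjoint) auto
    also have "sum z (insert D {D<..<2*k}) = z D + m"
      unfolding m_def by (rule sum.insert) auto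
    finally have ww: "z D + m + (\<Sum>v\<in>V. p v) = 2 *\<^sub>R w"
      unfolding sum_p scaleR_2 by (simp add: algebra_simps)
    have "card {D<..<2*k} = D - n - 1 - n" using n by (simp add: k_def D_def)
    moreover have "m \<in> S (card {D<..<2*k})"
      unfolding m_def using z H_slice by (intro sum_slice) auto
    ultimately have m: "m \<in> S (D - n - 1 - n)" by simp
    \<comment> \<open>One factor \<open>F\<close> is absorbed in \<open>G\<close>. The exponents
      \<open>g + m\<close> arising from the other have height \<open>D - n - 1\<close>, where the
      coefficients of \<open>G\<close> vanish.\<close>
    have "cf 0 (ell * lmonom m * F\<^sup>2 * Phi) = (\<Sum>g\<in>I. u g * cf (- (g + m)) G)"
    proof -
      have "ell * lmonom m * F\<^sup>2 * Phi = (\<Sum>g\<in>I. scalar (u g) * (lmonom (g + m) * G))"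
        by (simp add: G_def F_def power2_eq_square sum_distrib_left sum_distrib_right lmonom_add mult_ac)
      then show ?thesis by (simp add: cf_sum cf_scalar_mult cf_lmonom_mult)
    qed
    also have "\<dots> = 0"
    proof (intro sum.neutral ballI)
      fix g assume "g \<in> I"
      then have "g + m \<in> S (n + (D - n - 1 - n))" using m by (intro add_slice) (auto simp: I_def pbox_def)
      then have "g + m \<in> S (D - n - 1)" using n by (simp add: D_def)
      then show "u g * cf (- (g + m)) G = 0" by (simp only: GS mult_zero_right)
    qed
    finally have "cf (- ((z D + m + (\<Sum>v\<in>V. p v)) /\<^sub>R 2)) (F * Phi) = 0"
      unfolding ell_def by (rule cf_square_times_Phi[OF _ z p])
    then show ?thesis unfolding ww by simp
  qed
  \<comment> \<open>The coefficient of \<open>F * Phi\<close> at the negated complement of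
    \<open>g\<close> isolates \<open>u g\<close>: inductively all lower orders of the
    \<open>u h\<close> are zero, so only the leading monomial of \<open>Phi\<close> counts, and it
    matches \<open>h = g\<close> alone.\<close>
  have "\<forall>g\<in>I. u g $ N = 0" for N
  proof (induction N rule: less_induct)
    case (less N)
    show ?case
    proof
      fix g assume g: "g \<in> I"
      define w where "w = (\<Sum>v\<in>V. v) - g"
      have "w \<in> pbox (D - n)" using pbox_compl[of g n] g n by (simp add: w_def I_def D_def)
      then have "0 = cf (- w) (F * Phi) $ N" using FPhi by simp
      also have "\<dots> = (\<Sum>h\<in>I. (u h * cf (- w - h) Phi) $ N)"
        by (simp add: F_def sum_distrib_right mult.assoc cf_sum cf_scalar_mult cf_lmonom_mult fps_sum_nth)
      also have "\<dots> = (\<Sum>h\<in>I. if h = g then u g $ N else 0)"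
      proof (rule sum.cong)
        fix h assume h: "h \<in> I"
        have "(u h * cf (- w - h) Phi) $ N = (\<Sum>i=0..N. u h $ i * cf (- w - h) Phi $ (N - i))"
          by (rule fps_mult_nth)
        also have "\<dots> = (\<Sum>i=0..N. if i = N then u h $ N * cf (- w - h) Phi $ 0 else 0)"
          by (rule sum.cong) (use less h in auto)
        also have "\<dots> = u h $ N * cf (- w - h) Phi $ 0" by simp
        also have "cf (- w - h) Phi $ 0 = (if h = g then 1 else 0)"
          by (auto simp: cf_nth Phi_nth_0 lookup_single when_def w_def algebra_simps)
        finally show "(u h * cf (- w - h) Phi) $ N = (if h = g then u g $ N else 0)" by simp
      qed simp
      also have "\<dots> = u g $ N" using g by (simp add: I_def fin_pbox)
      finally show "u g $ N = 0" ..
    qed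
  qed
  then have "u g = 0" if "g \<in> I" for g
    using that by (intro fps_ext) simp
  with u(1) show False by blast
qed

end

section \<open>Lattice bases\<close>

text \<open>The functionals live on the whole space, but their values are determined only on
  \<open>span V\<close>.\<close>

definition dual_coords :: "'b::real_vector set \<Rightarrow> ('b \<Rightarrow> 'b \<Rightarrow> real) \<Rightarrow> bool" where
  "dual_coords V co \<longleftrightarrow>
     finite V \<and> (\<forall>v\<in>V. linear (co v)) \<and> (\<forall>v\<in>V. \<forall>w\<in>V. co v w = (if v = w then 1 else 0))"

lemma dual_coords_exist:
  assumes "finite V" "independent V"
  obtains co where "dual_coords V co"
proof -
  have "\<exists>f. linear f \<and> (\<forall>w\<in>V. f w = (if v = w then 1 else 0 :: real))" for v
    by (rule linear_independent_extend) (rule assms)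
  then obtain co where "\<And>v. linear (co v) \<and> (\<forall>w\<in>V. co v w = (if v = w then 1 else 0 :: real))"
    by metis
  then show thesis using assms(1) by (intro that[of co]) (simp add: dual_coords_def)
qed

lemma dual_coords_sum:
  assumes "dual_coords V co" "v \<in> V"
  shows "co v (\<Sum>w\<in>V. a w *\<^sub>R w) = a v"
proof -
  have "co v (\<Sum>w\<in>V. a w *\<^sub>R w) = (\<Sum>w\<in>V. a w * co v w)"
    using assms by (simp add: dual_coords_def linear_sum linear_scale)
  also have "\<dots> = (\<Sum>w\<in>V. if v = w then a w else 0)"
    using assms by (intro sum.cong) (auto simp: dual_coords_def)
  also have "\<dots> = a v" using assms by (simp add: dual_coords_def)
  finally show ?thesis .
qed

lemma dual_coords_expand:
  assumes "dual_coords V co" "x \<in> span V"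
  shows "x = (\<Sum>v\<in>V. co v x *\<^sub>R v)"
proof -
  have "finite V" using assms(1) by (simp add: dual_coords_def)
  then obtain a where "x = (\<Sum>v\<in>V. a v *\<^sub>R v)"
    using assms(2) by (auto simp: span_finite)
  then have "co v x = a v" if "v \<in> V" for v using dual_coords_sum[OF assms(1) that] by simp
  then show ?thesis using \<open>x = _\<close> by simp
qed

lemma dual_coords_subset: "dual_coords V co \<Longrightarrow> U \<subseteq> V \<Longrightarrow> dual_coords U co"
  unfolding dual_coords_def by (blast intro: finite_subset)

section \<open>Discrete subgroups and their bases\<close>

definition discrete_subgroup :: "'a::euclidean_space set \<Rightarrow> bool" where
  "discrete_subgroup L \<longleftrightarrow>
     0 \<in> L \<and> (\<forall>x\<in>L. \<forall>y\<in>L. x - y \<in> L) \<and> (\<forall>r. finite (L \<inter> cball 0 r))"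

lemma
  assumes "discrete_subgroup L"
  shows discrete_subgroup_zero: "0 \<in> L"
    and discrete_subgroup_diff: "x \<in> L \<Longrightarrow> y \<in> L \<Longrightarrow> x - y \<in> L"
    and discrete_subgroup_add: "x \<in> L \<Longrightarrow> y \<in> L \<Longrightarrow> x + y \<in> L"
    and discrete_subgroup_finite: "bounded S \<Longrightarrow> finite (L \<inter> S)"
proof -
  show 0: "0 \<in> L" and diff: "x \<in> L \<Longrightarrow> y \<in> L \<Longrightarrow> x - y \<in> L" for x y
    using assms by (auto simp: discrete_subgroup_def)
  show "x \<in> L \<Longrightarrow> y \<in> L \<Longrightarrow> x + y \<in> L"
    using diff[of x "0 - y"] diff[OF 0, of y] by simp
  assume "bounded S"
  then obtain r where "S \<subseteq> cball 0 r"
    using bounded_subset_ballD[of S 0] ball_subset_cball by blast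
  then have "L \<inter> S \<subseteq> L \<inter> cball 0 r" by blast
  then show "finite (L \<inter> S)"
    using assms unfolding discrete_subgroup_def by (meson finite_subset)
qed

lemma discrete_subgroup_scale:
  assumes "discrete_subgroup L" "x \<in> L"
  shows "real_of_int k *\<^sub>R x \<in> L"
proof -
  have nat: "real n *\<^sub>R x \<in> L" for n
    by (induction n) (auto simp: scaleR_add_left assms discrete_subgroup_zero discrete_subgroup_add)
  show ?thesis
  proof (cases "0 \<le> k")
    case True
    then show ?thesis using nat[of "nat k"] by simp
  next
    case False
    then show ?thesis
      using discrete_subgroup_diff[OF assms(1) discrete_subgroup_zero[OF assms(1)] nat[of "nat (- k)"]] by simp
  qed
qed

lemma discrete_subgroup_sum:
  assumes "discrete_subgroup L" "\<And>a. a \<in> A \<Longrightarrow> f a \<in> L"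
  shows "sum f A \<in> L"
  using assms(2)
  by (induction A rule: infinite_finite_induct)
    (auto simp: discrete_subgroup_zero[OF assms(1)] intro: discrete_subgroup_add[OF assms(1)])

lemma int_spanI: "(\<Sum>b\<in>B. real_of_int (c b) *\<^sub>R b) \<in> int_span B"
  unfolding int_span_def by (rule rangeI)

text \<open>The coordinate functionals of a basis are bounded, so a lattice point in a ball has
  integer coordinates in a bounded range.\<close>

lemma full_lattice_discrete_subgroup:
  assumes "full_lattice M"
  shows "discrete_subgroup M"
proof -
  obtain B where B: "finite B" "independent B" "M = int_span B"
    using assms unfolding full_lattice_def lattice_basis_def by blast
  obtain co where co: "dual_coords B co" using dual_coords_exist B by blast
  have "0 \<in> M" unfolding B(3) int_span_def by (rule range_eqI[of _ _ "\<lambda>_. 0"]) simp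
  moreover have "x - y \<in> M" if xy: "x \<in> M" "y \<in> M" for x y
  proof -
    obtain c d where "x = (\<Sum>b\<in>B. real_of_int (c b) *\<^sub>R b)" "y = (\<Sum>b\<in>B. real_of_int (d b) *\<^sub>R b)"
      using xy unfolding B(3) int_span_def by blast
    then have "x - y = (\<Sum>b\<in>B. real_of_int (c b - d b) *\<^sub>R b)"
      by (simp add: sum_subtractf scaleR_diff_left)
    then show ?thesis unfolding B(3) by (simp only: int_spanI)
  qed
  moreover have "finite (M \<inter> cball 0 r)" for r
  proof -
    have "\<forall>b\<in>B. \<exists>K. \<forall>x. \<bar>co b x\<bar> \<le> K * norm x"
      using co linear_bounded unfolding dual_coords_def real_norm_def[symmetric] by blast
    then obtain K where K: "\<And>b x. b \<in> B \<Longrightarrow> \<bar>co b x\<bar> \<le> K b * norm x"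
      by metis
    define N where "N b = \<lceil>\<bar>K b\<bar> * r\<rceil>" for b
    let ?P = "\<Pi>\<^sub>E b\<in>B. {- N b..N b}"
    have "M \<inter> cball 0 r \<subseteq> (\<lambda>c. \<Sum>b\<in>B. real_of_int (c b) *\<^sub>R b) ` ?P"
    proof
      fix x assume x: "x \<in> M \<inter> cball 0 r"
      then obtain c where c: "x = (\<Sum>b\<in>B. real_of_int (c b) *\<^sub>R b)"
        unfolding B(3) int_span_def by blast
      have "c b \<in> {- N b..N b}" if "b \<in> B" for b
      proof -
        have "\<bar>real_of_int (c b)\<bar> = \<bar>co b x\<bar>"
          unfolding c using dual_coords_sum[OF co that] by simp
        also have "\<dots> \<le> \<bar>K b\<bar> * norm x"
          using K[OF that, of x] by (meson abs_ge_self mult_right_mono norm_ge_zero order_trans)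
        also have "\<dots> \<le> \<bar>K b\<bar> * r" using x by (intro mult_left_mono) auto
        also have "\<dots> \<le> N b" by (simp add: N_def)
        finally show ?thesis by (simp add: abs_le_iff)
      qed
      then have "restrict c B \<in> ?P" by auto
      moreover have "x = (\<Sum>b\<in>B. real_of_int (restrict c B b) *\<^sub>R b)"
        unfolding c by (rule sum.cong) auto
      ultimately show "x \<in> (\<lambda>c. \<Sum>b\<in>B. real_of_int (c b) *\<^sub>R b) ` ?P" by blast
    qed
    moreover have "finite ?P" using B(1) by (intro finite_PiE) auto
    ultimately show ?thesis by (meson finite_imageI finite_subset)
  qed
  ultimately show ?thesis by (simp add: discrete_subgroup_def)
qed

lemma int_span_insert:
  assumes "finite B" "a \<notin> B"
  shows "int_span (insert a B) = {real_of_int q *\<^sub>R a + y |q y. y \<in> int_span B}"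
proof (intro equalityI subsetI)
  fix x assume "x \<in> int_span (insert a B)"
  then obtain c where "x = real_of_int (c a) *\<^sub>R a + (\<Sum>b\<in>B. real_of_int (c b) *\<^sub>R b)"
    using assms by (auto simp: int_span_def)
  then show "x \<in> {real_of_int q *\<^sub>R a + y |q y. y \<in> int_span B}"
    unfolding int_span_def by blast
next
  fix x assume "x \<in> {real_of_int q *\<^sub>R a + y |q y. y \<in> int_span B}"
  then obtain q c where x: "x = real_of_int q *\<^sub>R a + (\<Sum>b\<in>B. real_of_int (c b) *\<^sub>R b)"
    by (auto simp: int_span_def)
  have "(\<Sum>b\<in>insert a B. real_of_int ((c(a := q)) b) *\<^sub>R b) = x"
    using assms unfolding x by (auto intro!: sum.cong)
  then show "x \<in> int_span (insert a B)" using int_spanI by metis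
qed

text \<open>A basis is extended by a lattice vector whose coordinate in the new direction is positive and
  minimal.\<close>

lemma lattice_basis_in_span:
  fixes L :: "'a::euclidean_space set"
  assumes L: "discrete_subgroup L" and W: "finite W" "independent W" "W \<subseteq> L"
  shows "\<exists>B. lattice_basis (L \<inter> span W) B \<and> span B = span W"
  using W
proof (induction W rule: finite_induct)
  case empty
  have "lattice_basis (L \<inter> span {}) {}"
    using discrete_subgroup_zero[OF L] unfolding lattice_basis_def int_span_def
    by (simp add: independent_empty image_constant_conv)
  then show ?case by blast
next
  case (insert w W)
  have W: "independent W" "w \<notin> span W" "W \<subseteq> L" "w \<in> L"
    using insert by (auto simp: independent_insert)
  then obtain B where B: "finite B" "independent B" "L \<inter> span W = int_span B" "span B = span W"
    using insert.IH by (auto simp: lattice_basis_def)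
  obtain f :: "'a \<Rightarrow> real" where f: "linear f" "\<And>v. v \<in> insert w W \<Longrightarrow> f v = (if v = w then 1 else 0)"
    using linear_independent_extend[OF insert.prems(1), of "\<lambda>v. if v = w then 1 else 0 :: real"] by blast
  have f_span: "f x = 0" if "x \<in> span W" for x
    by (rule linear_eq_0_on_span[OF f(1) _ that]) (use f(2) insert.hyps in auto)
  have split: "x - f x *\<^sub>R w \<in> span W" if x: "x \<in> span (insert w W)" for x
  proof -
    obtain k where k: "x - k *\<^sub>R w \<in> span W" using x by (auto simp: span_breakdown_eq)
    have "f x - k * f w = 0"
      using f_span[OF k] by (simp add: linear_diff[OF f(1)] linear_scale[OF f(1)])
    then show ?thesis using k f(2)[of w] by simp
  qed
  \<comment> \<open>The candidates for the new basis vector; \<open>w\<close> is one of them.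
    Subtracting integer parts in the old basis keeps \<open>f\<close> and moves a candidate into a
    fixed ball, so \<open>f\<close> takes finitely many values on \<open>A\<close> and attains a
    minimum.\<close>
  define A where "A = {x \<in> L \<inter> span (insert w W). 0 < f x \<and> f x \<le> 1}"
  define r where "r = norm w + (\<Sum>b\<in>B. norm b)"
  have reduce: "\<exists>y \<in> L \<inter> cball 0 r. f y = f x" if "x \<in> A" for x
  proof -
    have x: "x \<in> L" "x \<in> span (insert w W)" "\<bar>f x\<bar> \<le> 1" using that by (auto simp: A_def)
    have "x - f x *\<^sub>R w \<in> span B" using split[OF x(2)] B(4) by simp
    then obtain a where a: "x - f x *\<^sub>R w = (\<Sum>b\<in>B. a b *\<^sub>R b)"
      unfolding span_finite[OF B(1)] by blast
    define y where "y = x - (\<Sum>b\<in>B. real_of_int \<lfloor>a b\<rfloor> *\<^sub>R b)"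
    have s: "(\<Sum>b\<in>B. real_of_int \<lfloor>a b\<rfloor> *\<^sub>R b) \<in> L \<inter> span W"
      unfolding B(3) by (rule int_spanI)
    have "y = f x *\<^sub>R w + ((x - f x *\<^sub>R w) - (\<Sum>b\<in>B. real_of_int \<lfloor>a b\<rfloor> *\<^sub>R b))"
      by (simp add: y_def)
    also have "\<dots> = f x *\<^sub>R w + (\<Sum>b\<in>B. frac (a b) *\<^sub>R b)"
      unfolding a by (simp add: frac_def scaleR_diff_left sum_subtractf)
    finally have "norm y \<le> norm (f x *\<^sub>R w + (\<Sum>b\<in>B. frac (a b) *\<^sub>R b))" by simp
    also have "\<dots> \<le> norm (f x *\<^sub>R w) + (\<Sum>b\<in>B. norm (frac (a b) *\<^sub>R b))"
      by (intro norm_triangle_mono norm_sum order_refl)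
    also have "\<dots> \<le> r"
      unfolding r_def
    proof (intro add_mono sum_mono)
      show "norm (f x *\<^sub>R w) \<le> norm w" using x(3) by (simp add: mult_left_le_one_le)
      show "norm (frac (a b) *\<^sub>R b) \<le> norm b" for b
        by (simp add: mult_left_le_one_le frac_ge_0 less_imp_le[OF frac_lt_1])
    qed
    finally have "norm y \<le> r" .
    moreover have "y \<in> L" using x(1) s discrete_subgroup_diff[OF L] by (auto simp: y_def)
    moreover have "f y = f x" using f_span s by (simp add: y_def linear_diff[OF f(1)])
    ultimately show ?thesis by (intro bexI[of _ y]) auto
  qed
  have "f ` A \<subseteq> f ` (L \<inter> cball 0 r)"
  proof (rule image_subsetI)
    fix x assume "x \<in> A"
    then obtain y where "y \<in> L \<inter> cball 0 r" "f y = f x" using reduce by blast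
    then show "f x \<in> f ` (L \<inter> cball 0 r)" by (intro rev_image_eqI[of y]) simp_all
  qed
  then have fin: "finite (f ` A)"
    using L finite_subset[OF _ finite_imageI] unfolding discrete_subgroup_def by blast
  have "w \<in> A" using W f(2) by (auto simp: A_def span_base)
  then have "Min (f ` A) \<in> f ` A" using fin by (intro Min_in) auto
  then obtain b0 where b0: "b0 \<in> A" "f b0 = Min (f ` A)" by auto
  have min: "f b0 \<le> f x" if "x \<in> A" for x using that fin b0 by simp
  have b0': "b0 \<in> L" "b0 \<in> span (insert w W)" "0 < f b0" "f b0 \<le> 1" using b0 by (auto simp: A_def)
  have b0_span: "b0 \<notin> span B" using f_span[of b0] b0' B(4) by auto
  then have "b0 \<notin> B" by (auto simp: span_base)
  note ins = int_span_insert[OF B(1) this]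
  have "L \<inter> span (insert w W) = int_span (insert b0 B)"
  proof (intro equalityI subsetI)
    fix x assume x: "x \<in> L \<inter> span (insert w W)"
    \<comment> \<open>Division with remainder by \<open>b0\<close>: a remainder with positive
      \<open>f\<close> would be a candidate below the minimum.\<close>
    define q where "q = \<lfloor>f x / f b0\<rfloor>"
    define y where "y = x - real_of_int q *\<^sub>R b0"
    have y: "y \<in> L" "y \<in> span (insert w W)"
      using x b0' unfolding y_def
      by (auto intro: discrete_subgroup_diff[OF L] discrete_subgroup_scale[OF L] span_diff span_scale)
    have fy: "f y = f b0 * frac (f x / f b0)"
      using b0' by (simp add: y_def q_def linear_diff[OF f(1)] linear_scale[OF f(1)] frac_def field_simps)
    have "\<not> 0 < f y"
    proof
      assume pos: "0 < f y"
      have "f y < f b0 * 1" unfolding fy using b0' frac_lt_1 by (intro mult_strict_left_mono) auto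
      then show False using min[of y] y pos b0' by (auto simp: A_def)
    qed
    moreover have "0 \<le> f y" unfolding fy using b0' by (simp add: frac_ge_0)
    ultimately have "y \<in> span W" using split[OF y(2)] by simp
    then have "y \<in> int_span B" using y B(3) by blast
    moreover have "x = real_of_int q *\<^sub>R b0 + y" by (simp add: y_def)
    ultimately show "x \<in> int_span (insert b0 B)" unfolding ins by blast
  next
    fix x assume "x \<in> int_span (insert b0 B)"
    then obtain q y where x: "x = real_of_int q *\<^sub>R b0 + y" "y \<in> L \<inter> span W"
      unfolding ins B(3) by blast
    moreover have "span W \<subseteq> span (insert w W)" by (rule span_mono) auto
    ultimately show "x \<in> L \<inter> span (insert w W)"
      using b0' by (auto intro!: discrete_subgroup_add[OF L] discrete_subgroup_scale[OF L] span_add span_scale)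
  qed
  moreover have "independent (insert b0 B)" using B b0_span by (simp add: independent_insertI)
  moreover have "span (insert b0 B) = span (insert w W)"
  proof (intro equalityI)
    have "B \<subseteq> span (insert w W)" using B(4) span_superset span_mono[of W "insert w W"] by blast
    then show "span (insert b0 B) \<subseteq> span (insert w W)" using b0' by (intro span_minimal) auto
    have sW: "span W \<subseteq> span (insert b0 B)" using span_mono[of B "insert b0 B"] B(4) by blast
    have "f b0 *\<^sub>R w = b0 - (b0 - f b0 *\<^sub>R w)" by simp
    also have "\<dots> \<in> span (insert b0 B)"
      by (rule span_diff) (use split[OF b0'(2)] sW in \<open>auto simp: span_base\<close>)
    finally have "(1 / f b0) *\<^sub>R (f b0 *\<^sub>R w) \<in> span (insert b0 B)" by (rule span_scale)
    then have "w \<in> span (insert b0 B)" using b0'(3) by simp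
    then show "span (insert w W) \<subseteq> span (insert b0 B)"
      using sW span_superset[of W] by (intro span_minimal) auto
  qed
  ultimately show ?case using B(1) unfolding lattice_basis_def by blast
qed

section \<open>Volumes by counting lattice cubes\<close>

text \<open>The set that is measured in \<open>basis_volume\<close>.\<close>

definition coord_set :: "'a::euclidean_space set \<Rightarrow> 'a set \<Rightarrow> ('a \<Rightarrow> real) set" where
  "coord_set B T = {c \<in> extensional B. (\<Sum>b\<in>B. c b *\<^sub>R b) \<in> T}"

text \<open>Being half-open, these cubes do not overlap; each point lies in the one named by the
  floors of its scaled coordinates.\<close>

definition cube :: "nat \<Rightarrow> 'a set \<Rightarrow> ('a \<Rightarrow> int) \<Rightarrow> ('a \<Rightarrow> real) set" where
  "cube n B z = (\<Pi>\<^sub>E b\<in>B. {real_of_int (z b) / real n ..< (real_of_int (z b) + 1) / real n})"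

lemma emeasure_cube:
  assumes "finite B" "0 < n"
  shows "emeasure (\<Pi>\<^sub>M b\<in>B. lborel) (cube n B z) = ennreal ((1 / real n) ^ card B)"
proof -
  interpret product_sigma_finite "\<lambda>_::'a. lborel :: real measure" ..
  have "emeasure (\<Pi>\<^sub>M b\<in>B. lborel) (cube n B z)
      = (\<Prod>b\<in>B. emeasure lborel {real_of_int (z b) / real n ..< (real_of_int (z b) + 1) / real n})"
    unfolding cube_def by (rule emeasure_PiM[OF assms(1)]) simp
  also have "\<dots> = (\<Prod>b\<in>B. ennreal (1 / real n))"
    using assms(2) by (intro prod.cong refl) (simp add: divide_right_mono flip: diff_divide_distrib)
  also have "\<dots> = ennreal ((1 / real n) ^ card B)"
    by (simp add: ennreal_power)
  finally show ?thesis .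
qed

lemma cube_sets: "finite B \<Longrightarrow> cube n B z \<in> sets (\<Pi>\<^sub>M b\<in>B. lborel)"
  unfolding cube_def by (rule sets_PiM_I_finite) auto

lemma coord_set_sets:
  assumes "finite B" "closed T"
  shows "coord_set B T \<in> sets (\<Pi>\<^sub>M b\<in>B. lborel)"
proof -
  have "(\<lambda>c. \<Sum>b\<in>B. c b *\<^sub>R b) \<in> borel_measurable (\<Pi>\<^sub>M b\<in>B. lborel)"
    by measurable
  then have "(\<lambda>c. \<Sum>b\<in>B. c b *\<^sub>R b) -` T \<inter> space (\<Pi>\<^sub>M b\<in>B. lborel) \<in> sets (\<Pi>\<^sub>M b\<in>B. lborel)"
    by (rule measurable_sets) (use assms in simp)
  moreover have "(\<lambda>c. \<Sum>b\<in>B. c b *\<^sub>R b) -` T \<inter> space (\<Pi>\<^sub>M b\<in>B. lborel) = coord_set B T"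
    by (auto simp: coord_set_def space_PiM PiE_def)
  ultimately show ?thesis by simp
qed

lemma mem_cube_iff:
  assumes "0 < n"
  shows "c \<in> cube n B z \<longleftrightarrow> c \<in> extensional B \<and> (\<forall>b\<in>B. \<lfloor>real n * c b\<rfloor> = z b)"
proof -
  have "real_of_int (z b) / real n \<le> c b \<and> c b < (real_of_int (z b) + 1) / real n \<longleftrightarrow> \<lfloor>real n * c b\<rfloor> = z b" for b
    using assms by (simp add: floor_eq_iff field_simps)
  then show ?thesis by (auto simp: cube_def PiE_iff)
qed

lemma coord_set_upper:
  assumes "finite B" "0 < n" "finite Q"
    and cover: "\<And>c. c \<in> coord_set B T \<Longrightarrow> (\<lambda>b\<in>B. \<lfloor>real n * c b\<rfloor>) \<in> Q"
  shows "emeasure (\<Pi>\<^sub>M b\<in>B. lborel) (coord_set B T) \<le> ennreal (real (card Q) * (1 / real n) ^ card B)"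
proof -
  have "coord_set B T \<subseteq> (\<Union>z\<in>Q. cube n B z)"
  proof
    fix c assume c: "c \<in> coord_set B T"
    have "c \<in> cube n B (\<lambda>b\<in>B. \<lfloor>real n * c b\<rfloor>)"
      using c by (simp add: mem_cube_iff[OF assms(2)] coord_set_def)
    then show "c \<in> (\<Union>z\<in>Q. cube n B z)" using cover[OF c] by blast
  qed
  then have "emeasure (\<Pi>\<^sub>M b\<in>B. lborel) (coord_set B T) \<le> emeasure (\<Pi>\<^sub>M b\<in>B. lborel) (\<Union>z\<in>Q. cube n B z)"
    by (rule emeasure_mono) (use assms in \<open>auto intro: cube_sets\<close>)
  also have "\<dots> \<le> (\<Sum>z\<in>Q. emeasure (\<Pi>\<^sub>M b\<in>B. lborel) (cube n B z))"
    by (rule emeasure_subadditive_finite) (use assms in \<open>auto intro: cube_sets\<close>)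
  also have "\<dots> = ennreal (real (card Q) * (1 / real n) ^ card B)"
    by (simp add: emeasure_cube[OF assms(1,2)] ennreal_mult ennreal_of_nat_eq_real_of_nat)
  finally show ?thesis .
qed

lemma coord_set_lower:
  assumes "finite B" "0 < n" "finite Q" "closed T" "Q \<subseteq> extensional B"
    and cover: "\<And>z c. z \<in> Q \<Longrightarrow> c \<in> extensional B \<Longrightarrow> (\<And>b. b \<in> B \<Longrightarrow> \<lfloor>real n * c b\<rfloor> = z b)
      \<Longrightarrow> (\<Sum>b\<in>B. c b *\<^sub>R b) \<in> T"
  shows "ennreal (real (card Q) * (1 / real n) ^ card B) \<le> emeasure (\<Pi>\<^sub>M b\<in>B. lborel) (coord_set B T)"
proof -
  have disj: "disjoint_family_on (cube n B) Q"
    unfolding disjoint_family_on_def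
  proof (intro ballI impI)
    fix z z' assume z: "z \<in> Q" "z' \<in> Q" "z \<noteq> z'"
    then obtain b where "b \<in> B" "z b \<noteq> z' b"
      using assms(5) by (meson extensionalityI subsetD)
    then show "cube n B z \<inter> cube n B z' = {}"
      by (auto simp: mem_cube_iff[OF assms(2)])
  qed
  have "ennreal (real (card Q) * (1 / real n) ^ card B) = (\<Sum>z\<in>Q. emeasure (\<Pi>\<^sub>M b\<in>B. lborel) (cube n B z))"
    by (simp add: emeasure_cube[OF assms(1,2)] ennreal_mult ennreal_of_nat_eq_real_of_nat)
  also have "\<dots> = emeasure (\<Pi>\<^sub>M b\<in>B. lborel) (\<Union>z\<in>Q. cube n B z)"
    by (rule sum_emeasure[OF _ disj assms(3)]) (use assms in \<open>auto intro: cube_sets\<close>)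
  also have "\<dots> \<le> emeasure (\<Pi>\<^sub>M b\<in>B. lborel) (coord_set B T)"
  proof (rule emeasure_mono)
    show "(\<Union>z\<in>Q. cube n B z) \<subseteq> coord_set B T"
      using cover by (auto simp: mem_cube_iff[OF assms(2)] coord_set_def)
  qed (rule coord_set_sets[OF assms(1,4)])
  finally show ?thesis .
qed

section \<open>Counting weak compositions\<close>

definition compositions :: "'a set \<Rightarrow> nat \<Rightarrow> ('a \<Rightarrow> nat) set" where
  "compositions U N = {f \<in> extensional U. sum f U = N}"

text \<open>Stars and bars, transferred from lists along an enumeration of \<open>U\<close>.\<close>

lemma card_compositions:
  assumes "finite U" "card U = Suc k"
  shows "finite (compositions U N)" "card (compositions U N) = (N + k) choose k"
proof -
  obtain xs where xs: "set xs = U" "distinct xs" using finite_distinct_list[OF assms(1)] by blast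
  have len: "length xs = Suc k" using assms xs distinct_card by fastforce
  have bij: "bij_betw (\<lambda>f. map f xs) (compositions U N) {l. length l = Suc k \<and> sum_list l = N}"
  proof (rule bij_betw_byWitness[where f' = "\<lambda>l. \<lambda>u\<in>U. the (map_of (zip xs l) u)"])
    show "\<forall>f\<in>compositions U N. (\<lambda>u\<in>U. the (map_of (zip xs (map f xs)) u)) = f"
      by (auto simp: compositions_def map_of_zip_map xs extensional_def)
    have map_id: "map (\<lambda>u\<in>U. the (map_of (zip xs l) u)) xs = l" if "length l = Suc k" for l :: "nat list"
    proof (rule nth_equalityI)
      fix i assume "i < length (map (\<lambda>u\<in>U. the (map_of (zip xs l) u)) xs)"
      then have i: "i < length xs" by simp
      then have "map_of (zip xs l) (xs ! i) = Some (l ! i)"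
        using that len xs by (intro map_of_zip_nth) auto
      then show "map (\<lambda>u\<in>U. the (map_of (zip xs l) u)) xs ! i = l ! i"
        using i xs by (auto simp: restrict_def)
    qed (use that len in simp)
    then show "\<forall>l\<in>{l. length l = Suc k \<and> sum_list l = N}. map (\<lambda>u\<in>U. the (map_of (zip xs l) u)) xs = l"
      by blast
    have sum: "sum_list (map f xs) = sum f U" for f :: "'a \<Rightarrow> nat"
      using sum_list_distinct_conv_sum_set[OF xs(2), of f] xs(1) by simp
    then show "(\<lambda>f. map f xs) ` compositions U N \<subseteq> {l. length l = Suc k \<and> sum_list l = N}"
      by (auto simp: compositions_def len)
    show "(\<lambda>l. \<lambda>u\<in>U. the (map_of (zip xs l) u)) ` {l. length l = Suc k \<and> sum_list l = N} \<subseteq> compositions U N"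
    proof (rule image_subsetI)
      fix l assume l: "l \<in> {l. length l = Suc k \<and> sum_list l = N}"
      then show "(\<lambda>u\<in>U. the (map_of (zip xs l) u)) \<in> compositions U N"
        using sum[of "\<lambda>u\<in>U. the (map_of (zip xs l) u)"] map_id[of l] by (simp add: compositions_def)
    qed
  qed
  have "card {l::nat list. length l = Suc k \<and> sum_list l = N} = (N + k) choose k"
    using card_length_sum_list[of "Suc k" N] binomial_symmetric[of k "N + k"] by simp
  moreover have "finite {l::nat list. length l = Suc k \<and> sum_list l = N}"
  proof (rule finite_subset)
    show "{l::nat list. length l = Suc k \<and> sum_list l = N} \<subseteq> {l. set l \<subseteq> {..N} \<and> length l = Suc k}"
      using member_le_sum_list by auto
  qed (rule finite_lists_length_eq, simp)
  ultimately show "finite (compositions U N)" "card (compositions U N) = (N + k) choose k"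
    using bij_betw_finite[OF bij] bij_betw_same_card[OF bij] by simp_all
qed

text \<open>Together with the upper bound \<open>binomial_fact_pow\<close> this shows that the
  number of compositions grows like N^k / k!, the source of the factorial in the volume
  estimates.\<close>

lemma power_le_fact_binomial: "N ^ k \<le> fact k * ((N + k) choose k)"
proof (induction k)
  case (Suc k)
  have "N ^ Suc k \<le> Suc (N + k) * (fact k * ((N + k) choose k))"
    unfolding power_Suc by (rule mult_mono) (use Suc in auto)
  also have "\<dots> = fact k * (Suc k * (Suc (N + k) choose Suc k))"
    by (simp only: Suc_times_binomial mult_ac)
  finally show ?case by (simp only: fact_Suc of_nat_id add_Suc_right mult_ac)
qed simp

section \<open>Simplices placed at height one\<close>

definition hat :: "'a::real_vector set \<Rightarrow> ('a \<times> real) set" where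
  "hat U = (\<lambda>w. (w, 1)) ` U"

lemma finite_hat [simp]: "finite (hat U) \<longleftrightarrow> finite U"
  unfolding hat_def by (rule finite_image_iff) (auto simp: inj_on_def)

lemma card_hat [simp]: "card (hat U) = card U"
  unfolding hat_def by (rule card_image) (auto simp: inj_on_def)

lemma sum_hat: "(\<Sum>p\<in>hat U. f p) = (\<Sum>w\<in>U. f (w, 1))"
  unfolding hat_def by (simp add: sum.reindex inj_on_def)

text \<open>The last component of a linear relation says that its coefficients add up to zero, which
  makes it an affine relation among the original points.\<close>

lemma independent_hat:
  assumes "finite U" "\<not> affine_dependent U"
  shows "independent (hat U)"
proof
  assume "dependent (hat U)"
  then obtain a where a: "\<exists>p\<in>hat U. a p \<noteq> 0" "(\<Sum>p\<in>hat U. a p *\<^sub>R p) = 0"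
    using assms(1) by (auto simp: dependent_finite)
  have "(\<Sum>w\<in>U. a (w, 1) *\<^sub>R (w, 1::real)) = 0" using a(2) by (simp add: sum_hat)
  then have "(\<Sum>w\<in>U. a (w, 1) *\<^sub>R w) = 0" "(\<Sum>w\<in>U. a (w, 1)) = 0"
    by (auto simp: prod_eq_iff fst_sum snd_sum)
  then have "affine_dependent U"
    using a(1) unfolding affine_dependent_explicit_finite[OF assms(1)]
    by (intro exI[of _ "\<lambda>w. a (w, 1)"]) (auto simp: hat_def)
  with assms(2) show False by contradiction
qed

lemma hat_expand:
  assumes "dual_coords (hat U) co" "p \<in> span (hat U)"
  shows "fst p = (\<Sum>w\<in>U. co (w, 1) p *\<^sub>R w)" "snd p = (\<Sum>w\<in>U. co (w, 1) p)"
proof -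
  have p: "p = (\<Sum>w\<in>U. co (w, 1) p *\<^sub>R (w, 1))"
    using dual_coords_expand[OF assms] by (simp add: sum_hat)
  show "fst p = (\<Sum>w\<in>U. co (w, 1) p *\<^sub>R w)"
    by (subst (1) p) (simp add: fst_sum)
  show "snd p = (\<Sum>w\<in>U. co (w, 1) p)"
    by (subst (1) p) (simp add: snd_sum)
qed

lemma hat_combination:
  assumes "finite U"
  shows "((\<Sum>w\<in>U. a w *\<^sub>R w), (\<Sum>w\<in>U. a w)) = (\<Sum>p\<in>hat U. a (fst p) *\<^sub>R p)"
  by (simp add: sum_hat prod_eq_iff fst_sum snd_sum)

text \<open>The dual coordinates of \<open>(x, 1)\<close> are the barycentric coordinates of
  \<open>x\<close>; the last component makes their sum one.\<close>

lemma convex_hull_hat: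
  assumes "finite U" "dual_coords (hat U) co"
  shows "convex hull U = {x. (x, 1) \<in> span (hat U) \<and> (\<forall>w\<in>U. 0 \<le> co (w, 1) (x, 1))}"
proof (intro equalityI subsetI)
  fix x assume "x \<in> convex hull U"
  then obtain a where a: "\<forall>w\<in>U. 0 \<le> a w" "sum a U = 1" "(\<Sum>w\<in>U. a w *\<^sub>R w) = x"
    using assms(1) by (auto simp: convex_hull_finite)
  then have x: "(x, 1) = (\<Sum>p\<in>hat U. a (fst p) *\<^sub>R p)"
    using hat_combination[OF assms(1), of a] by simp
  have "(x, 1) \<in> span (hat U)"
    unfolding x by (intro span_sum span_scale span_base)
  moreover have "co (w, 1) (x, 1) = a w" if "w \<in> U" for w
    using dual_coords_sum[OF assms(2), of "(w, 1)" "\<lambda>p. a (fst p)"] that unfolding x by (simp add: hat_def)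
  ultimately show "x \<in> {x. (x, 1) \<in> span (hat U) \<and> (\<forall>w\<in>U. 0 \<le> co (w, 1) (x, 1))}"
    using a(1) by simp
next
  fix x assume x: "x \<in> {x. (x, 1) \<in> span (hat U) \<and> (\<forall>w\<in>U. 0 \<le> co (w, 1) (x, 1))}"
  then have "x = (\<Sum>w\<in>U. co (w, 1) (x, 1) *\<^sub>R w)" "1 = (\<Sum>w\<in>U. co (w, 1) (x, 1))"
    using hat_expand[OF assms(2), of "(x, 1)"] by auto
  then show "x \<in> convex hull U"
    using x unfolding convex_hull_finite[OF assms(1)]
    by (intro CollectI exI[of _ "\<lambda>w. co (w, 1) (x, 1)"]) auto
qed

text \<open>At height zero the coordinates add up to zero, so \<open>v0\<close> may be subtracted
  from every vertex in the expansion. The direction space of the simplex is thus the height zero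
  part of the span.\<close>

lemma span_translate_convex_hull:
  assumes "finite U" "dual_coords (hat U) co" "v0 \<in> convex hull U"
  shows "span ((\<lambda>x. x - v0) ` (convex hull U)) = {x. (x, 0) \<in> span (hat U)}" (is "?A = ?S")
    and "span ((\<lambda>x. x - v0) ` U) = {x. (x, 0) \<in> span (hat U)}" (is "?B = _")
proof -
  have sub: "subspace ?S"
    unfolding subspace_def
    using span_zero[of "hat U"] span_add[of _ "hat U"] span_scale[of _ "hat U"]
    by (auto simp: zero_prod_def) (metis add.right_neutral add_Pair, metis mult_zero_right real_scaleR_def scaleR_Pair)
  have "x - v0 \<in> ?S" if "x \<in> convex hull U" for x
  proof -
    have "(x, 1) \<in> span (hat U)" "(v0, 1) \<in> span (hat U)"
      using that assms(3) convex_hull_hat[OF assms(1,2)] by auto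
    then have "(x, 1) - (v0, 1) \<in> span (hat U)" by (rule span_diff)
    then show ?thesis by simp
  qed
  then have "?A \<subseteq> ?S" by (intro span_minimal sub) auto
  moreover have "?B \<subseteq> ?A" by (intro span_mono image_mono hull_subset)
  moreover have "?S \<subseteq> ?B"
  proof
    fix x assume "x \<in> ?S"
    then have x: "x = (\<Sum>w\<in>U. co (w, 1) (x, 0) *\<^sub>R w)" "0 = (\<Sum>w\<in>U. co (w, 1) (x, 0))"
      using hat_expand[OF assms(2), of "(x, 0)"] by auto
    have "x = (\<Sum>w\<in>U. co (w, 1) (x, 0) *\<^sub>R w) - (\<Sum>w\<in>U. co (w, 1) (x, 0)) *\<^sub>R v0"
      using x by simp
    also have "\<dots> = (\<Sum>w\<in>U. co (w, 1) (x, 0) *\<^sub>R (w - v0))"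
      by (simp add: scaleR_diff_right sum_subtractf scaleR_sum_left)
    also have "\<dots> \<in> ?B" by (intro span_sum span_scale span_base imageI)
    finally show "x \<in> ?B" .
  qed
  ultimately show "?A = ?S" "?B = ?S" by auto
qed

section \<open>Lattice simplices in the coordinates of a lattice basis\<close>

locale simplex_volume =
  fixes M U B :: "'a::euclidean_space set" and co :: "'a \<times> real \<Rightarrow> 'a \<times> real \<Rightarrow> real" and v0 :: 'a
  assumes M: "discrete_subgroup M" and finU: "finite U" and UM: "U \<subseteq> M"
    and co: "dual_coords (hat U) co"
    and v0: "v0 \<in> M" "v0 \<in> convex hull U"
    and B: "lattice_basis (M \<inter> {x. (x, 0) \<in> span (hat U)}) B"
begin

abbreviation T :: "'a set" where "T \<equiv> (\<lambda>x. x - v0) ` (convex hull U)"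

abbreviation comb :: "('a \<Rightarrow> int) \<Rightarrow> 'a" where "comb z \<equiv> \<Sum>b\<in>B. real_of_int (z b) *\<^sub>R b"

definition coord :: "'a \<Rightarrow> 'a \<Rightarrow> real" where "coord w x = co (w, 1) (x, 0)"

text \<open>The barycentric coordinates of the base point, which may be any lattice point of the
  simplex.\<close>

definition base_coord :: "'a \<Rightarrow> real" where "base_coord w = co (w, 1) (v0, 1)"

text \<open>A bound, uniform in \<open>n\<close>, for the change of the \<open>n\<close>-fold
  barycentric coordinates when a point is replaced by the corner of its cube; see
  \<open>coord_floor_bound\<close>.\<close>

definition slack :: nat where "slack = nat \<lceil>\<Sum>b\<in>B. \<Sum>w\<in>U. \<bar>coord w b\<bar>\<rceil>"

lemma finB: "finite B" and indB: "independent B"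
  and B_span: "M \<inter> {x. (x, 0) \<in> span (hat U)} = int_span B"
  using B by (auto simp: lattice_basis_def)

lemma co_linear: "w \<in> U \<Longrightarrow> linear (co (w, 1))"
  using co by (auto simp: dual_coords_def hat_def)

lemma coord_linear:
  assumes "w \<in> U"
  shows "linear (coord w)"
proof (rule linearI)
  show "coord w (x + y) = coord w x + coord w y" for x y
    using linear_add[OF co_linear[OF assms], of "(x, 0)" "(y, 0)"] by (simp add: coord_def)
  show "coord w (r *\<^sub>R x) = r *\<^sub>R coord w x" for r x
    using linear_scale[OF co_linear[OF assms], of r "(x, 0)"] by (simp add: coord_def)
qed

lemma co_shift: "w \<in> U \<Longrightarrow> co (w, 1) (x + r *\<^sub>R v0, r) = coord w x + r * base_coord w"
  using linear_add[OF co_linear, of w "(x, 0)" "r *\<^sub>R (v0, 1)"] linear_scale[OF co_linear, of w r "(v0, 1)"]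
  by (simp add: coord_def base_coord_def)

lemma v0_span: "(v0, 1) \<in> span (hat U)" and base_coord_nonneg: "w \<in> U \<Longrightarrow> 0 \<le> base_coord w"
  using v0(2) convex_hull_hat[OF finU co] by (auto simp: base_coord_def)

lemma B_in_span: "b \<in> B \<Longrightarrow> (b, 0) \<in> span (hat U)"
proof -
  assume b: "b \<in> B"
  have "b = (\<Sum>b'\<in>B. real_of_int (if b' = b then 1 else 0) *\<^sub>R b')"
    using b finB by (simp add: if_distrib[of real_of_int] if_distrib[of "\<lambda>c. c *\<^sub>R _"] cong: if_cong)
  then have "b \<in> int_span B" using int_spanI by metis
  then show ?thesis using B_span by blast
qed

lemma T_iff: "x \<in> T \<longleftrightarrow> (x, 0) \<in> span (hat U) \<and> (\<forall>w\<in>U. 0 \<le> coord w x + base_coord w)"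
proof -
  have "x \<in> T \<longleftrightarrow> x + v0 \<in> convex hull U" by (force simp: image_iff algebra_simps)
  also have "\<dots> \<longleftrightarrow> (x + v0, 1) \<in> span (hat U) \<and> (\<forall>w\<in>U. 0 \<le> coord w x + base_coord w)"
    using co_shift[of _ x 1] by (simp add: convex_hull_hat[OF finU co])
  also have "(x + v0, 1) \<in> span (hat U) \<longleftrightarrow> (x, 0) \<in> span (hat U)"
    using span_add_eq2[OF v0_span, of "(x, 0)"] by simp
  finally show ?thesis .
qed

lemma closed_T: "closed T"
  using finU by (intro compact_imp_closed compact_continuous_image finite_imp_compact_convex_hull)
    (auto intro!: continuous_intros)

lemma sum_in_span: "((\<Sum>b\<in>B. c b *\<^sub>R b), 0) \<in> span (hat U)"
proof -
  have "((\<Sum>b\<in>B. c b *\<^sub>R b), 0) = (\<Sum>b\<in>B. c b *\<^sub>R (b, 0))"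
    by (simp add: prod_eq_iff fst_sum snd_sum)
  also have "\<dots> \<in> span (hat U)" by (intro span_sum span_scale B_in_span)
  finally show ?thesis .
qed

lemma coord_floor_bound:
  assumes w: "w \<in> U" and z: "\<And>b. b \<in> B \<Longrightarrow> \<lfloor>real n * c b\<rfloor> = z b"
  shows "\<bar>real n * coord w (\<Sum>b\<in>B. c b *\<^sub>R b) - coord w (comb z)\<bar> \<le> real slack"
proof -
  have "real n * coord w (\<Sum>b\<in>B. c b *\<^sub>R b) - coord w (comb z) = (\<Sum>b\<in>B. (real n * c b - real_of_int (z b)) * coord w b)"
    using coord_linear[OF w] by (simp add: linear_sum linear_scale sum_distrib_left left_diff_distrib sum_subtractf mult.assoc)
  also have "\<bar>\<dots>\<bar> \<le> (\<Sum>b\<in>B. \<bar>(real n * c b - real_of_int (z b)) * coord w b\<bar>)" by (rule sum_abs)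
  also have "\<dots> \<le> (\<Sum>b\<in>B. \<Sum>w\<in>U. \<bar>coord w b\<bar>)"
  proof (rule sum_mono)
    fix b assume "b \<in> B"
    have "\<bar>real n * c b - real_of_int (z b)\<bar> \<le> 1"
      using z[OF \<open>b \<in> B\<close>] by (simp add: floor_eq_iff abs_le_iff)
    then have "\<bar>(real n * c b - real_of_int (z b)) * coord w b\<bar> \<le> \<bar>coord w b\<bar>"
      by (simp add: abs_mult mult_left_le_one_le)
    also have "\<dots> \<le> (\<Sum>w\<in>U. \<bar>coord w b\<bar>)"
      using w finU by (intro member_le_sum) auto
    finally show "\<bar>(real n * c b - real_of_int (z b)) * coord w b\<bar> \<le> (\<Sum>w\<in>U. \<bar>coord w b\<bar>)" .
  qed
  also have "\<dots> \<le> real slack" unfolding slack_def by linarith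
  finally show ?thesis .
qed

lemma comb_inj:
  assumes "comb z = comb z'" "z \<in> extensional B" "z' \<in> extensional B"
  shows "z = z'"
proof (rule extensionalityI[OF assms(2,3)])
  fix b assume b: "b \<in> B"
  have "(\<Sum>b\<in>B. (real_of_int (z b) - real_of_int (z' b)) *\<^sub>R b) = 0"
    using assms(1) by (simp add: scaleR_diff_left sum_subtractf)
  then have "real_of_int (z b) - real_of_int (z' b) = 0"
    by (rule independentD[OF indB finB order_refl _ b])
  then show "z b = z' b" by simp
qed

lemma comb_surj:
  assumes "x \<in> M" "(x, 0) \<in> span (hat U)"
  obtains z where "z \<in> extensional B" "comb z = x"
proof -
  have "x \<in> int_span B" using assms B_span by blast
  then obtain c where "x = comb c" unfolding int_span_def by blast
  moreover have "comb (restrict c B) = comb c" by (rule sum.cong) auto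
  ultimately show thesis by (intro that[of "restrict c B"]) auto
qed

lemma comb_coord: "comb z = (\<Sum>w\<in>U. coord w (comb z) *\<^sub>R w)" "(\<Sum>w\<in>U. coord w (comb z)) = 0"
  using hat_expand[OF co sum_in_span[of "\<lambda>b. real_of_int (z b)"]] by (auto simp: coord_def)

lemma sum_base_coord: "(\<Sum>w\<in>U. base_coord w) = 1"
  using hat_expand(2)[OF co v0_span] by (simp add: base_coord_def)

text \<open>The corner of a cube that meets the simplex has scaled coordinates of at least
  \<open>- slack\<close>. They are integers by \<open>int\<close> and because \<open>v0\<close> is a
  vertex. After adding \<open>slack\<close> they form a weak composition of
  \<open>n + slack * Suc k\<close>, from which the cube can be recovered.\<close>

lemma volume_upper:
  assumes card: "card U = Suc k" and B_card: "card B = k" and n: "0 < n"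
    and v0U: "v0 \<in> U" and int: "\<And>x w. x \<in> M \<Longrightarrow> (x, 0) \<in> span (hat U) \<Longrightarrow> w \<in> U \<Longrightarrow> coord w x \<in> \<int>"
  shows "emeasure (\<Pi>\<^sub>M b\<in>B. lborel) (coord_set B T)
      \<le> ennreal (real ((n + slack * Suc k + k) choose k) * (1 / real n) ^ k)"
proof -
  define Q where "Q = {z \<in> extensional B. \<forall>w\<in>U. 0 \<le> coord w (comb z) + real n * base_coord w + real slack}"
  define \<psi> where "\<psi> z = (\<lambda>w\<in>U. nat \<lfloor>coord w (comb z) + real n * base_coord w + real slack\<rfloor>)" for z
  have \<psi>: "real (\<psi> z w) = coord w (comb z) + real n * base_coord w + real slack" if "z \<in> Q" "w \<in> U" for z w
  proof -
    have "comb z \<in> M" using B_span int_spanI by blast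
    then have "coord w (comb z) \<in> \<int>" by (rule int[OF _ sum_in_span that(2)])
    moreover have "base_coord w \<in> \<int>"
      using co v0U that(2) by (auto simp: base_coord_def dual_coords_def hat_def)
    ultimately have "coord w (comb z) + real n * base_coord w + real slack \<in> \<int>" by simp
    then show ?thesis using that by (auto simp: \<psi>_def Q_def elim!: Ints_cases)
  qed
  have "\<psi> ` Q \<subseteq> compositions U (n + slack * Suc k)"
  proof (rule image_subsetI)
    fix z assume z: "z \<in> Q"
    have "(\<Sum>w\<in>U. real (\<psi> z w)) = (\<Sum>w\<in>U. coord w (comb z) + real n * base_coord w + real slack)"
      using \<psi>[OF z] by (rule sum.cong[OF refl])
    also have "\<dots> = real (n + slack * Suc k)"
      using card by (simp add: sum.distrib comb_coord(2) sum_base_coord algebra_simps flip: sum_distrib_left)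
    finally have "(\<Sum>w\<in>U. \<psi> z w) = n + slack * Suc k" by (simp only: of_nat_sum[symmetric] of_nat_eq_iff)
    then show "\<psi> z \<in> compositions U (n + slack * Suc k)" by (simp add: compositions_def \<psi>_def)
  qed
  moreover have inj: "inj_on \<psi> Q"
  proof (rule inj_onI)
    fix z z' assume z: "z \<in> Q" "z' \<in> Q" "\<psi> z = \<psi> z'"
    have "coord w (comb z) = coord w (comb z')" if "w \<in> U" for w
      using \<psi>[OF z(1) that] \<psi>[OF z(2) that] z(3) by simp
    then have "comb z = comb z'" using comb_coord(1)[of z] comb_coord(1)[of z'] by simp
    then show "z = z'" using z by (intro comb_inj) (auto simp: Q_def)
  qed
  ultimately have "finite Q" "card Q \<le> (n + slack * Suc k + k) choose k"
    using card_compositions[OF finU card, of "n + slack * Suc k"] card_inj_on_le[of \<psi> Q] inj_on_finite[of \<psi> Q]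
    by metis+
  have "emeasure (\<Pi>\<^sub>M b\<in>B. lborel) (coord_set B T) \<le> ennreal (real (card Q) * (1 / real n) ^ card B)"
  proof (rule coord_set_upper[OF finB n \<open>finite Q\<close>])
    fix c assume c: "c \<in> coord_set B T"
    let ?z = "\<lambda>b\<in>B. \<lfloor>real n * c b\<rfloor>"
    have "0 \<le> coord w (comb ?z) + real n * base_coord w + real slack" if w: "w \<in> U" for w
    proof -
      have "0 \<le> coord w (\<Sum>b\<in>B. c b *\<^sub>R b) + base_coord w" using c w T_iff by (simp add: coord_set_def)
      then have "0 \<le> real n * (coord w (\<Sum>b\<in>B. c b *\<^sub>R b) + base_coord w)" by simp
      then show ?thesis using coord_floor_bound[OF w, of n c ?z] by (simp add: distrib_left abs_le_iff)
    qed
    then show "?z \<in> Q" by (simp add: Q_def)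
  qed
  also have "\<dots> \<le> ennreal (real ((n + slack * Suc k + k) choose k) * (1 / real n) ^ k)"
    using \<open>card Q \<le> _\<close> unfolding B_card by (intro ennreal_leI mult_right_mono) simp_all
  finally show ?thesis .
qed

text \<open>The points of \<open>X\<close> lie in the half-open parallelepiped over \<open>U\<close>, so each of them contributes its own
  translate of the sublattice spanned by \<open>U\<close>.\<close>

lemma volume_lower:
  assumes card: "card U = Suc k" and B_card: "card B = k" and n: "0 < n" and D: "R + slack * Suc k \<le> n"
    and finX: "finite X" and XM: "\<And>x r. (x, r) \<in> X \<Longrightarrow> x \<in> M \<and> r \<le> R \<and> (x, real r) \<in> span (hat U)"
    and X1: "\<And>x r w. (x, r) \<in> X \<Longrightarrow> w \<in> U \<Longrightarrow> 0 \<le> co (w, 1) (x, real r) \<and> co (w, 1) (x, real r) < 1"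
  shows "ennreal (real (card X * ((n - R - slack * Suc k + k) choose k)) * (1 / real n) ^ k)
    \<le> emeasure (\<Pi>\<^sub>M b\<in>B. lborel) (coord_set B T)"
proof -
  define P where "P = Sigma X (\<lambda>\<xi>. compositions U (n - snd \<xi> - slack * Suc k))"
  \<comment> \<open>The point of height \<open>r\<close> is raised to height \<open>n\<close> by
    vertices and brought back to height zero by \<open>n\<close> copies of \<open>v0\<close>. Each
    vertex is used at least \<open>slack\<close> times, which keeps the whole cube at this corner
    inside the simplex.\<close>
  define pt where "pt q = fst (fst q) + (\<Sum>w\<in>U. real (snd q w + slack) *\<^sub>R w) - real n *\<^sub>R v0"
    for q :: "('a \<times> nat) \<times> ('a \<Rightarrow> nat)"
  have pt: "pt q \<in> M" "(pt q, 0) \<in> span (hat U)"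
    "\<And>w. w \<in> U \<Longrightarrow> coord w (pt q) + real n * base_coord w = co (w, 1) (fst (fst q), real (snd (fst q))) + real (snd q w + slack)"
    if "q \<in> P" for q
  proof -
    obtain x r f where q: "q = ((x, r), f)" by (metis prod.collapse)
    have x: "x \<in> M" "r \<le> R" "(x, real r) \<in> span (hat U)" and f: "f \<in> compositions U (n - r - slack * Suc k)"
      using that XM[of x r] by (auto simp: P_def q)
    let ?s = "\<Sum>w\<in>U. real (f w + slack) *\<^sub>R w"
    have M_scale: "real i *\<^sub>R y \<in> M" if "y \<in> M" for i y
      using discrete_subgroup_scale[OF M that, of "int i"] by simp
    show "pt q \<in> M"
      unfolding pt_def q fst_conv snd_conv
      using x(1) UM v0(1) by (intro discrete_subgroup_diff[OF M] discrete_subgroup_add[OF M]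
          discrete_subgroup_sum[OF M] M_scale) auto
    have "(\<Sum>w\<in>U. f w + slack) = n - r"
      using f x(2) D card by (simp add: compositions_def sum.distrib)
    then have total: "(\<Sum>w\<in>U. real (f w + slack)) = real n - real r"
      using x(2) D by (simp only: of_nat_sum[symmetric] of_nat_diff)
    define y where "y = (x, real r) + (\<Sum>w\<in>U. real (f w + slack) *\<^sub>R (w, 1::real))"
    have y: "y = (pt q + real n *\<^sub>R v0, real n)"
      using total by (simp add: y_def pt_def q prod_eq_iff fst_sum snd_sum)
    have "y \<in> span (hat U)"
      unfolding y_def by (intro span_add x(3) span_sum span_scale) (auto simp: hat_def intro: span_base)
    then have "y - real n *\<^sub>R (v0, 1) \<in> span (hat U)" using v0_span by (intro span_diff span_scale)
    then show "(pt q, 0) \<in> span (hat U)" by (simp add: y)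
    fix w assume w: "w \<in> U"
    have "coord w (pt q) + real n * base_coord w = co (w, 1) y" using co_shift[OF w] by (simp add: y)
    also have "\<dots> = co (w, 1) (x, real r) + co (w, 1) (\<Sum>p\<in>hat U. real (f (fst p) + slack) *\<^sub>R p)"
      unfolding y_def by (simp add: linear_add[OF co_linear[OF w]] sum_hat)
    also have "co (w, 1) (\<Sum>p\<in>hat U. real (f (fst p) + slack) *\<^sub>R p) = real (f w + slack)"
      using dual_coords_sum[OF co, of "(w, 1)" "\<lambda>p. real (f (fst p) + slack)"] w by (simp add: hat_def)
    finally show "coord w (pt q) + real n * base_coord w = co (w, 1) (fst (fst q), real (snd (fst q))) + real (snd q w + slack)"
      by (simp add: q)
  qed
  have "\<forall>q\<in>P. \<exists>z. z \<in> extensional B \<and> comb z = pt q"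
  proof
    fix q assume "q \<in> P"
    then obtain z where "z \<in> extensional B" "comb z = pt q"
      using comb_surj[OF pt(1) pt(2), of q] by blast
    then show "\<exists>z. z \<in> extensional B \<and> comb z = pt q" by blast
  qed
  then obtain \<zeta> where "\<forall>q\<in>P. \<zeta> q \<in> extensional B \<and> comb (\<zeta> q) = pt q"
    using bchoice[of P "\<lambda>q z. z \<in> extensional B \<and> comb z = pt q"] by blast
  then have \<zeta>: "\<And>q. q \<in> P \<Longrightarrow> \<zeta> q \<in> extensional B" "\<And>q. q \<in> P \<Longrightarrow> comb (\<zeta> q) = pt q"
    by blast+
  have inj: "inj_on \<zeta> P"
  proof (rule inj_onI)
    fix q q' assume q: "q \<in> P" "q' \<in> P" "\<zeta> q = \<zeta> q'"
    have eq: "pt q = pt q'" using \<zeta>(2)[OF q(1)] \<zeta>(2)[OF q(2)] q(3) by simp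
    let ?c = "\<lambda>q w. co (w, 1) (fst (fst q), real (snd (fst q)))"
    have X: "0 \<le> ?c q w \<and> ?c q w < 1" if "q \<in> P" "w \<in> U" for q w
      using X1[of "fst (fst q)" "snd (fst q)" w] that by (auto simp: P_def)
    \<comment> \<open>As \<open>?c\<close> takes values in [0, 1), integer and fractional parts
      separate: two integers that differ by less than one agree.\<close>
    have *: "snd q w = snd q' w \<and> ?c q w = ?c q' w" if w: "w \<in> U" for w
    proof -
      have "?c q w + real (snd q w) = ?c q' w + real (snd q' w)"
        using pt(3)[OF q(1) w] pt(3)[OF q(2) w] eq by simp
      moreover from this have "\<bar>real (snd q w) - real (snd q' w)\<bar> < 1"
        using X[OF q(1) w] X[OF q(2) w] by linarith
      then have "\<bar>int (snd q w) - int (snd q' w)\<bar> < 1" by linarith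
      ultimately show ?thesis by simp
    qed
    have "snd q = snd q'"
      by (rule extensionalityI[of _ U]) (use q * in \<open>auto simp: P_def compositions_def\<close>)
    moreover have "(fst (fst q), real (snd (fst q))) = (fst (fst q'), real (snd (fst q')))"
    proof -
      have sp: "(fst (fst q), real (snd (fst q))) \<in> span (hat U)" if "q \<in> P" for q
        using that XM[of "fst (fst q)" "snd (fst q)"] by (auto simp: P_def)
      show ?thesis
        using hat_expand[OF co sp[OF q(1)]] hat_expand[OF co sp[OF q(2)]] * by (simp add: prod_eq_iff)
    qed
    ultimately show "q = q'" by (auto simp: prod_eq_iff)
  qed
  have finP: "finite P" unfolding P_def using finX card_compositions(1)[OF finU card] by (intro finite_SigmaI)
  have "card X * ((n - R - slack * Suc k + k) choose k) = (\<Sum>\<xi>\<in>X. (n - R - slack * Suc k + k) choose k)" by simp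
  also have "\<dots> \<le> (\<Sum>\<xi>\<in>X. (n - snd \<xi> - slack * Suc k + k) choose k)"
  proof (rule sum_mono)
    fix \<xi> assume "\<xi> \<in> X"
    then have "snd \<xi> \<le> R" using XM[of "fst \<xi>" "snd \<xi>"] by simp
    then show "(n - R - slack * Suc k + k) choose k \<le> (n - snd \<xi> - slack * Suc k + k) choose k"
      by (intro binomial_right_mono add_mono diff_le_mono diff_le_mono2 order_refl)
  qed
  also have "\<dots> = card (\<zeta> ` P)"
    unfolding card_image[OF inj] unfolding P_def
    using finX card_compositions[OF finU card] by (simp add: card_SigmaI)
  finally have "ennreal (real (card X * ((n - R - slack * Suc k + k) choose k)) * (1 / real n) ^ k)
      \<le> ennreal (real (card (\<zeta> ` P)) * (1 / real n) ^ card B)"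
    unfolding B_card by (intro ennreal_leI mult_right_mono) (simp_all only: of_nat_le_iff zero_le_power zero_le_divide_1_iff of_nat_0_le_iff)
  also have "\<dots> \<le> emeasure (\<Pi>\<^sub>M b\<in>B. lborel) (coord_set B T)"
  proof (rule coord_set_lower[OF finB n _ closed_T])
    show "finite (\<zeta> ` P)" using finP by simp
    show "\<zeta> ` P \<subseteq> extensional B" using \<zeta>(1) by blast
    fix z c assume z: "z \<in> \<zeta> ` P" and c: "\<And>b. b \<in> B \<Longrightarrow> \<lfloor>real n * c b\<rfloor> = z b"
    obtain q where q: "q \<in> P" "z = \<zeta> q" using z by blast
    have "0 \<le> coord w (\<Sum>b\<in>B. c b *\<^sub>R b) + base_coord w" if w: "w \<in> U" for w
    proof -
      have "0 \<le> co (w, 1) (fst (fst q), real (snd (fst q)))"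
        using X1[of "fst (fst q)" "snd (fst q)" w] q(1) w by (auto simp: P_def)
      then have "real slack \<le> coord w (comb z) + real n * base_coord w"
        using pt(3)[OF q(1) w] \<zeta>(2)[OF q(1)] q(2) by simp
      moreover have "\<bar>real n * coord w (\<Sum>b\<in>B. c b *\<^sub>R b) - coord w (comb z)\<bar> \<le> real slack"
        by (rule coord_floor_bound[OF w c])
      ultimately have "0 \<le> real n * (coord w (\<Sum>b\<in>B. c b *\<^sub>R b) + base_coord w)"
        by (simp add: distrib_left abs_le_iff)
      then show ?thesis using n by (simp add: zero_le_mult_iff)
    qed
    then show "(\<Sum>b\<in>B. c b *\<^sub>R b) \<in> T" using T_iff sum_in_span by blast
  qed
  finally show ?thesis .
qed

end

section \<open>Normalized volumes as limits of counts\<close>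

lemma shifted_ratio_power_tendsto: "(\<lambda>n. ((real n + a) / real n) ^ k) \<longlonglongrightarrow> 1"
proof -
  have "(\<lambda>n. (1 + a / real n) ^ k) \<longlonglongrightarrow> (1 + 0) ^ k"
    by (intro tendsto_intros lim_const_over_n)
  then have "(\<lambda>n. (1 + a / real n) ^ k) \<longlonglongrightarrow> 1" by simp
  moreover have "\<forall>\<^sub>F n in sequentially. (1 + a / real n) ^ k = ((real n + a) / real n) ^ k"
    using eventually_gt_at_top[of 0] by eventually_elim (simp add: add_divide_distrib)
  ultimately show ?thesis by (rule Lim_transform_eventually)
qed

context simplex_volume
begin

abbreviation vol :: real where "vol \<equiv> measure (\<Pi>\<^sub>M b\<in>B. lborel) (coord_set B T)"

text \<open>The bound of \<open>volume_upper\<close>, times \<open>fact k\<close>, is at most ((n +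
  const) / n)^k, which tends to one. Finiteness is recorded because \<open>measure\<close> is zero
  on sets of infinite measure.\<close>

lemma fact_volume_le_1:
  assumes card: "card U = Suc k" and B_card: "card B = k"
    and v0U: "v0 \<in> U" and int: "\<And>x w. x \<in> M \<Longrightarrow> (x, 0) \<in> span (hat U) \<Longrightarrow> w \<in> U \<Longrightarrow> coord w x \<in> \<int>"
  shows "fact k * vol \<le> 1" "emeasure (\<Pi>\<^sub>M b\<in>B. lborel) (coord_set B T) \<noteq> \<infinity>"
proof -
  note upper = volume_upper[OF card B_card _ v0U int]
  show "emeasure (\<Pi>\<^sub>M b\<in>B. lborel) (coord_set B T) \<noteq> \<infinity>"
    using upper[of 1] by (auto simp: top_unique)
  have "fact k * vol \<le> ((real n + real (slack * Suc k + k)) / real n) ^ k" if n: "n \<ge> 1" for n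
  proof -
    let ?m = "n + slack * Suc k + k"
    have "vol \<le> real (?m choose k) * (1 / real n) ^ k"
      using upper[of n] n unfolding measure_def by (intro enn2real_leI) auto
    then have "fact k * vol \<le> real ((?m choose k) * fact k) * (1 / real n) ^ k"
      by (simp add: mult_ac mult_left_mono)
    also have "\<dots> \<le> real (?m ^ k) * (1 / real n) ^ k"
      by (intro mult_right_mono of_nat_mono binomial_fact_pow) simp
    also have "\<dots> = ((real n + real (slack * Suc k + k)) / real n) ^ k"
      by (simp add: power_divide add.assoc)
    finally show ?thesis .
  qed
  then show "fact k * vol \<le> 1"
    by (intro LIMSEQ_le_const[OF shifted_ratio_power_tendsto]) blast
qed

text \<open>Each element of \<open>X\<close> accounts for a share of 1 / k! of the volume: the count
  in \<open>volume_lower\<close> is at least the cardinality of \<open>X\<close> times (n - D)^k /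
  k!, and \<open>n\<close> tends to infinity.\<close>

lemma card_le_fact_volume:
  assumes card: "card U = Suc k" and B_card: "card B = k"
    and finX: "finite X" and XM: "\<And>x r. (x, r) \<in> X \<Longrightarrow> x \<in> M \<and> r \<le> R \<and> (x, real r) \<in> span (hat U)"
    and X1: "\<And>x r w. (x, r) \<in> X \<Longrightarrow> w \<in> U \<Longrightarrow> 0 \<le> co (w, 1) (x, real r) \<and> co (w, 1) (x, real r) < 1"
    and fin: "emeasure (\<Pi>\<^sub>M b\<in>B. lborel) (coord_set B T) \<noteq> \<infinity>"
  shows "real (card X) \<le> fact k * vol"
proof -
  define D where "D = R + slack * Suc k"
  have "real (card X) * ((real n + (- real D)) / real n) ^ k \<le> fact k * vol" if n: "n \<ge> Suc D" for n
  proof -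
    let ?m = "n - R - slack * Suc k"
    have m: "real ?m = real n - real D" using n by (simp add: D_def of_nat_diff)
    have "ennreal (real (card X * ((?m + k) choose k)) * (1 / real n) ^ k)
        \<le> emeasure (\<Pi>\<^sub>M b\<in>B. lborel) (coord_set B T)"
      by (rule volume_lower[OF card B_card _ _ finX XM X1]) (use n in \<open>auto simp: D_def\<close>)
    then have "enn2real (ennreal (real (card X * ((?m + k) choose k)) * (1 / real n) ^ k)) \<le> vol"
      unfolding measure_def using fin by (intro enn2real_mono) (auto simp: top.not_eq_extremum)
    then have vol: "real (card X * ((?m + k) choose k)) * (1 / real n) ^ k \<le> vol"
      by (simp only: enn2real_ennreal mult_nonneg_nonneg of_nat_0_le_iff zero_le_power zero_le_divide_1_iff)
    have "real (card X) * ((real n + (- real D)) / real n) ^ k = real (card X * ?m ^ k) * (1 / real n) ^ k"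
      by (simp add: m[symmetric] power_divide)
    also have "\<dots> \<le> real (card X * (fact k * ((?m + k) choose k))) * (1 / real n) ^ k"
      by (intro mult_right_mono of_nat_mono mult_left_mono power_le_fact_binomial) simp_all
    also have "\<dots> = fact k * (real (card X * ((?m + k) choose k)) * (1 / real n) ^ k)"
      by simp
    also have "\<dots> \<le> fact k * vol" using vol by (intro mult_left_mono) simp_all
    finally show ?thesis .
  qed
  moreover have "(\<lambda>n. real (card X) * ((real n + (- real D)) / real n) ^ k) \<longlonglongrightarrow> real (card X) * 1"
    by (intro tendsto_mult tendsto_const shifted_ratio_power_tendsto)
  ultimately show ?thesis
    using LIMSEQ_le_const2[of "\<lambda>n. real (card X) * ((real n + (- real D)) / real n) ^ k"
        "real (card X) * 1" "fact k * vol"] by auto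
qed

end

text \<open>Resolves the two choices made in \<open>normalized_volume\<close>: the vertices are
  lattice points of the hull, and \<open>lattice_basis_in_span\<close> provides a basis. The
  translated vertices lie in the span of that basis, so its size is the dimension.\<close>

lemma normalized_volume_simplex:
  fixes M U :: "'a::euclidean_space set"
  assumes M: "discrete_subgroup M" and U: "finite U" "U \<noteq> {}" "U \<subseteq> M" "\<not> affine_dependent U"
    and co: "dual_coords (hat U) co" and card: "card U = Suc k"
  obtains v0 B where "simplex_volume M U B co v0" "card B = k"
    "normalized_volume M (convex hull U)
      = fact k * measure (\<Pi>\<^sub>M b\<in>B. lborel) (coord_set B ((\<lambda>x. x - v0) ` (convex hull U)))"
proof -
  let ?F = "convex hull U"
  define v0 where "v0 = (SOME v. v \<in> ?F \<inter> M)"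
  have "\<exists>v. v \<in> ?F \<inter> M" using U by (auto intro: hull_inc)
  then have v0: "v0 \<in> ?F" "v0 \<in> M" using someI_ex[of "\<lambda>v. v \<in> ?F \<inter> M"] by (auto simp: v0_def)
  note sp = span_translate_convex_hull[OF U(1) co v0(1)]
  have ind: "induced_lattice M ?F v0 = M \<inter> {x. (x, 0) \<in> span (hat U)}"
    unfolding induced_lattice_def sp(1) ..
  define B where "B = (SOME B. lattice_basis (induced_lattice M ?F v0) B)"
  obtain W where W: "W \<subseteq> (\<lambda>x. x - v0) ` U" "independent W" "(\<lambda>x. x - v0) ` U \<subseteq> span W"
    using maximal_independent_subset by blast
  have "span W = {x. (x, 0) \<in> span (hat U)}"
    using W span_mono[OF W(1)] span_minimal[OF W(3) subspace_span] sp(2) by blast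
  moreover have "finite W" using W(1) U(1) finite_subset by blast
  moreover have trans_M: "(\<lambda>x. x - v0) ` U \<subseteq> M" using U(3) v0(2) discrete_subgroup_diff[OF M] by blast
  moreover have "W \<subseteq> M" using W(1) trans_M by blast
  ultimately have "\<exists>B. lattice_basis (induced_lattice M ?F v0) B"
    using lattice_basis_in_span[OF M _ W(2)] ind by metis
  then have B: "lattice_basis (M \<inter> {x. (x, 0) \<in> span (hat U)}) B"
    using someI_ex[of "lattice_basis (induced_lattice M ?F v0)"] ind by (simp add: B_def)
  interpret simplex_volume M U B co v0
    by unfold_locales (use M U co v0 B in auto)
  have "span B = span ((\<lambda>x. x - v0) ` ?F)"
  proof
    show "span B \<subseteq> span ((\<lambda>x. x - v0) ` ?F)"
      unfolding sp(1) using B_in_span sum_in_span by (auto simp: span_finite[OF finB])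
    have "(\<lambda>x. x - v0) ` U \<subseteq> M \<inter> {x. (x, 0) \<in> span (hat U)}"
      by (rule Int_greatest[OF trans_M span_superset[of "(\<lambda>x. x - v0) ` U", unfolded sp(2)]])
    also have "\<dots> \<subseteq> span B"
      unfolding B_span int_span_def by (auto intro: span_sum span_scale span_base)
    finally show "span ((\<lambda>x. x - v0) ` ?F) \<subseteq> span B"
      unfolding sp(1) sp(2)[symmetric] by (intro span_minimal subspace_span)
  qed
  then have "dim ((\<lambda>x. x - v0) ` ?F) = card B"
    using dim_span[of "(\<lambda>x. x - v0) ` ?F"] dim_span[of B] indB by (simp add: dim_eq_card_independent)
  moreover have "aff_dim ?F = int (dim ((\<lambda>x. x - v0) ` ?F))"
    by (rule aff_dim_eq_dim_subtract[OF hull_inc[OF v0(2)]])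
  moreover have "aff_dim ?F = int k"
    using aff_dim_affine_independent[OF U(4)] card by (simp add: aff_dim_convex_hull)
  ultimately have k: "card B = k" "aff_dim ?F = int k" by simp_all
  have "normalized_volume M ?F = fact k * vol"
    unfolding normalized_volume_def Let_def v0_def[symmetric] B_def[symmetric] basis_volume_def coord_set_def k(2)
    by simp
  then show thesis using that simplex_volume_axioms k(1) by blast
qed

text \<open>By \<open>empty\<close> the chosen base point is a vertex, so
  \<open>fact_volume_le_1\<close> applies. The reverse bound comes from taking the origin as the
  only element of \<open>X\<close>.\<close>

lemma unimodularI:
  fixes M U :: "'a::euclidean_space set"
  assumes M: "discrete_subgroup M" and U: "finite U" "U \<noteq> {}" "U \<subseteq> M" "\<not> affine_dependent U"
    and co: "dual_coords (hat U) co"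
    and empty: "convex hull U \<inter> M \<subseteq> U"
    and int: "\<And>x w. x \<in> M \<Longrightarrow> (x, 0) \<in> span (hat U) \<Longrightarrow> w \<in> U \<Longrightarrow> co (w, 1) (x, 0) \<in> \<int>"
  shows "unimodular M (convex hull U)"
proof -
  obtain k where card: "card U = Suc k" using U by (metis card_eq_0_iff not0_implies_Suc)
  obtain v0 B where vB: "simplex_volume M U B co v0" "card B = k"
    "normalized_volume M (convex hull U)
      = fact k * measure (\<Pi>\<^sub>M b\<in>B. lborel) (coord_set B ((\<lambda>x. x - v0) ` (convex hull U)))"
    using normalized_volume_simplex[OF M U co card] by blast
  interpret simplex_volume M U B co v0 by (rule vB(1))
  have "v0 \<in> U" using v0 empty by blast
  then have "fact k * vol \<le> 1" "emeasure (\<Pi>\<^sub>M b\<in>B. lborel) (coord_set B T) \<noteq> \<infinity>"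
    using fact_volume_le_1[OF card vB(2)] int by (auto simp: coord_def)
  moreover have "real (card {(0::'a, 0::nat)}) \<le> fact k * vol"
  proof (rule card_le_fact_volume[OF card vB(2), where R = 0])
    show "x \<in> M \<and> r \<le> 0 \<and> (x, real r) \<in> span (hat U)" if "(x, r) \<in> {(0::'a, 0::nat)}" for x r
      using that discrete_subgroup_zero[OF M] span_zero[of "hat U"] by (simp add: zero_prod_def)
    show "0 \<le> co (w, 1) (x, real r) \<and> co (w, 1) (x, real r) < 1"
      if "(x, r) \<in> {(0::'a, 0::nat)}" "w \<in> U" for x r w
      using that linear_0[OF co_linear] by (simp add: zero_prod_def)
  qed (use \<open>emeasure _ _ \<noteq> \<infinity>\<close> in auto)
  ultimately show ?thesis using vB(3) by (simp add: unimodular_def)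
qed

text \<open>Beside the origin, a further lattice point would give a second coset of the lattice
  spanned by the lifted vertices, and so a normalized volume of at least two.\<close>

lemma unimodularD:
  fixes M U :: "'a::euclidean_space set"
  assumes M: "discrete_subgroup M" and U: "finite U" "U \<noteq> {}" "U \<subseteq> M" "\<not> affine_dependent U"
    and unimod: "unimodular M (convex hull U)"
  shows "convex hull U \<inter> M \<subseteq> U"
proof (rule ccontr)
  assume "\<not> convex hull U \<inter> M \<subseteq> U"
  then obtain x0 where x0: "x0 \<in> convex hull U" "x0 \<in> M" "x0 \<notin> U" by blast
  obtain co where co: "dual_coords (hat U) co"
    using dual_coords_exist[of "hat U"] independent_hat U by auto
  obtain k where card: "card U = Suc k" using U by (metis card_eq_0_iff not0_implies_Suc)
  obtain v0 B where vB: "simplex_volume M U B co v0" "card B = k"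
    "normalized_volume M (convex hull U)
      = fact k * measure (\<Pi>\<^sub>M b\<in>B. lborel) (coord_set B ((\<lambda>x. x - v0) ` (convex hull U)))"
    using normalized_volume_simplex[OF M U co card] by blast
  interpret simplex_volume M U B co v0 by (rule vB(1))
  have vol: "fact k * vol = 1" using unimod vB(3) by (simp add: unimodular_def)
  \<comment> \<open>On a set of infinite measure \<open>measure\<close> has the default value
    zero.\<close>
  then have fin: "emeasure (\<Pi>\<^sub>M b\<in>B. lborel) (coord_set B T) \<noteq> \<infinity>"
    by (auto simp: measure_def)
  have x0_span: "(x0, 1) \<in> span (hat U)" and x0_nonneg: "\<And>w. w \<in> U \<Longrightarrow> 0 \<le> co (w, 1) (x0, 1)"
    using x0(1) convex_hull_hat[OF U(1) co] by auto
  \<comment> \<open>A barycentric coordinate of one forces the others to vanish, and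
    \<open>x0\<close> would be that vertex.\<close>
  have x0_less: "co (w, 1) (x0, 1) < 1" if w: "w \<in> U" for w
  proof (rule ccontr)
    assume ge: "\<not> co (w, 1) (x0, 1) < 1"
    have sum: "(\<Sum>u\<in>U. co (u, 1) (x0, 1)) = 1" "x0 = (\<Sum>u\<in>U. co (u, 1) (x0, 1) *\<^sub>R u)"
      using hat_expand[OF co x0_span] by auto
    then have rest: "co (w, 1) (x0, 1) + (\<Sum>u\<in>U - {w}. co (u, 1) (x0, 1)) = 1"
      using w U(1) by (simp add: sum.remove)
    moreover have nonneg: "0 \<le> (\<Sum>u\<in>U - {w}. co (u, 1) (x0, 1))"
      using x0_nonneg by (intro sum_nonneg) auto
    ultimately have "(\<Sum>u\<in>U - {w}. co (u, 1) (x0, 1)) = 0" "co (w, 1) (x0, 1) = 1"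
      using ge by linarith+
    then have "\<forall>u\<in>U - {w}. co (u, 1) (x0, 1) = 0"
      using sum_nonneg_eq_0_iff[of "U - {w}" "\<lambda>u. co (u, 1) (x0, 1)"] U(1) x0_nonneg by auto
    then have "x0 = w"
      using sum(2) w U(1) \<open>co (w, 1) (x0, 1) = 1\<close> by (simp add: sum.remove[of U w])
    then show False using x0(3) w by simp
  qed
  let ?X = "{(0::'a, 0::nat), (x0, 1)}"
  have "real (card ?X) \<le> fact k * vol"
  proof (rule card_le_fact_volume[OF card vB(2), where R = 1])
    show "x \<in> M \<and> r \<le> 1 \<and> (x, real r) \<in> span (hat U)" if "(x, r) \<in> ?X" for x r
      using that discrete_subgroup_zero[OF M] span_zero[of "hat U"] x0(2) x0_span by (auto simp: zero_prod_def)
    show "0 \<le> co (w, 1) (x, real r) \<and> co (w, 1) (x, real r) < 1"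
      if "(x, r) \<in> ?X" "w \<in> U" for x r w
      using that linear_0[OF co_linear] x0_nonneg x0_less by (auto simp: zero_prod_def)
  qed (use fin in auto)
  then show False using vol by simp
qed

section \<open>The simplex and the cone over it\<close>

lemma unimodal_by_consecutive:
  assumes k: "k < length a"
    and inc: "\<And>i. i < k \<Longrightarrow> a ! i \<le> a ! Suc i"
    and dec: "\<And>i. k \<le> i \<Longrightarrow> Suc i < length a \<Longrightarrow> a ! Suc i \<le> a ! i"
  shows "unimodal a"
  unfolding unimodal_def
proof (intro exI conjI)
  show "sorted (take (Suc k) a)" using inc k by (simp add: sorted_iff_nth_Suc)
  have "transp ((\<ge>) :: 'a \<Rightarrow> 'a \<Rightarrow> bool)" by (auto intro: transpI)
  then show "sorted_wrt (\<ge>) (drop k a)" using dec k by (simp add: sorted_wrt_iff_nth_Suc_transp)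
qed (rule k)

text \<open>The counts increase up to the middle by \<open>card_pbox_le\<close> and decrease
  afterwards by complementation. Index zero has no complement in the list and is compared directly
  with index one.\<close>

lemma (in clean_idp_cone) unimodal_pbox:
  assumes "2 \<le> card V"
  shows "unimodal (map (\<lambda>i. real (card (pbox i))) [0..<card V])"
proof -
  define D where "D = card V"
  let ?a = "map (\<lambda>i. real (card (pbox i))) [0..<D]"
  have "unimodal ?a"
  proof (cases "pbox 1 = {}")
    case True
    \<comment> \<open>Here the vector is 1, 0, ..., 0.\<close>
    have "pbox (Suc i) = {}" for i using pbox_1_empty[OF True, of "Suc i"] by simp
    then show ?thesis using assms by (intro unimodal_by_consecutive[of 0]) (auto simp: D_def)
  next
    case False
    then have "1 \<le> card (pbox 1)" using fin_pbox[of 1] by (simp add: Suc_le_eq card_gt_0_iff)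
    then have inc: "card (pbox i) \<le> card (pbox (Suc i))" if "2 * i < D" for i
      using card_pbox_le[of i] that by (cases "i = 0") (simp_all add: pbox_zero D_def)
    \<comment> \<open>The mirror image of \<open>inc\<close>: the bound
      \<open>D div 2 \<le> i\<close> puts \<open>D - Suc i\<close> below the middle.\<close>
    have dec: "card (pbox (Suc i)) \<le> card (pbox i)" if i: "D div 2 \<le> i" "Suc i < D" for i
    proof -
      have "1 \<le> i" "2 * (D - Suc i) < D" using i assms by (auto simp: D_def)
      then have "card (pbox (D - Suc i)) \<le> card (pbox (D - i))"
        using inc[of "D - Suc i"] i by (simp add: Suc_diff_Suc)
      then show ?thesis
        using card_pbox_compl[of i] card_pbox_compl[of "Suc i"] i \<open>1 \<le> i\<close> by (simp add: D_def)
    qed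
    show ?thesis
    proof (rule unimodal_by_consecutive[of "D div 2"])
      show "D div 2 < length ?a" using assms by (simp add: D_def)
      show "?a ! i \<le> ?a ! Suc i" if "i < D div 2" for i
      proof -
        have "2 * i < D" "Suc i < D" using that by linarith+
        then show ?thesis using inc[of i] by simp
      qed
      show "?a ! Suc i \<le> ?a ! i" if "D div 2 \<le> i" "Suc i < length ?a" for i
        using dec[of i] that by simp
    qed
  qed
  then show ?thesis by (simp add: D_def)
qed

text \<open>\<open>1 - fps_X\<close> is invertible, so the description defining
  \<open>hstar_poly\<close> has exactly one solution, read off from the product.\<close>

lemma hstar_vector_eq:
  assumes series: "ehrhart_series M P * (1 - fps_X) ^ Suc (nat (aff_dim P)) = Abs_fps f"
    and zero: "\<And>n. n > nat (aff_dim P) \<Longrightarrow> f n = 0"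
  shows "hstar_vector M P = map f [0..<Suc (nat (aff_dim P))]"
proof -
  define d where "d = nat (aff_dim P)"
  define h where "h = (\<Sum>i\<le>d. monom (f i) i)"
  have coeff: "coeff h n = f n" for n
    using zero[of n] by (auto simp: h_def d_def coeff_sum sum.delta)
  have fps_h: "fps_of_poly h = Abs_fps f" by (rule fps_ext) (simp add: coeff)
  have iff: "ehrhart_series M P = fps_of_poly g / (1 - fps_X) ^ (d + 1) \<longleftrightarrow> fps_of_poly g = fps_of_poly h" for g
  proof -
    let ?u = "(1 - fps_X :: real fps) ^ (d + 1)"
    have unit: "inverse ?u * ?u = 1" by (rule inverse_mult_eq_1) simp
    have "fps_of_poly g / ?u = fps_of_poly g * inverse ?u" by (rule fps_divide_unit) simp
    moreover have h: "ehrhart_series M P * ?u = fps_of_poly h"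
      using series fps_h by (simp only: d_def Suc_eq_plus1)
    moreover have "fps_of_poly g * inverse ?u * ?u = fps_of_poly g"
      unfolding mult.assoc unit by simp
    moreover have "ehrhart_series M P * ?u * inverse ?u = ehrhart_series M P"
      using unit by (simp only: mult.assoc mult.commute[of ?u] mult_1_right)
    ultimately show ?thesis by metis
  qed
  have "hstar_poly M P = h"
    unfolding hstar_poly_def
  proof (rule the_equality)
    have "degree h \<le> d" unfolding h_def by (rule degree_sum_le) (auto intro: order_trans[OF degree_monom_le])
    then show "degree h \<le> nat (aff_dim P) \<and>
        ehrhart_series M P = fps_of_poly h / (1 - fps_X) ^ (nat (aff_dim P) + 1)"
      using iff[of h] by (simp add: d_def)
    show "g = h" if "degree g \<le> nat (aff_dim P) \<and>
        ehrhart_series M P = fps_of_poly g / (1 - fps_X) ^ (nat (aff_dim P) + 1)" for g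
      using iff[of g] that by (simp add: d_def fps_of_poly_eq_iff)
  qed
  then show ?thesis by (simp add: hstar_vector_def coeff)
qed

lemma convex_hull_remove:
  assumes "finite V" "dual_coords (hat V) co" "x \<in> convex hull V" "co (u, 1) (x, 1) = 0"
  shows "x \<in> convex hull (V - {u})"
proof -
  have x: "(x, 1) \<in> span (hat V)" "\<forall>w\<in>V. 0 \<le> co (w, 1) (x, 1)"
    using assms convex_hull_hat by auto
  have "(\<Sum>w\<in>V - {u}. co (w, 1) (x, 1)) = 1" "(\<Sum>w\<in>V - {u}. co (w, 1) (x, 1) *\<^sub>R w) = x"
    using hat_expand[OF assms(2) x(1)] assms(1,4) by (auto simp: sum_diff1)
  then show ?thesis
    using x(2) assms(1) by (auto simp: convex_hull_finite intro!: exI[of _ "\<lambda>w. co (w, 1) (x, 1)"])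
qed

text \<open>The extreme points lie among the generators and generate the polytope by Krein-Milman.
  Having one vertex more than the dimension is affine independence.\<close>

lemma lattice_simplex_vertices:
  assumes "lattice_simplex M \<Delta>"
  shows "finite (vertices \<Delta>)" "vertices \<Delta> \<subseteq> M" "\<Delta> = convex hull (vertices \<Delta>)"
    "\<not> affine_dependent (vertices \<Delta>)"
proof -
  obtain S where S: "finite S" "S \<subseteq> M" "\<Delta> = convex hull S"
    using assms by (auto simp: lattice_simplex_def lattice_polytope_def)
  have sub: "vertices \<Delta> \<subseteq> S"
    using extreme_point_of_convex_hull unfolding vertices_def S(3) by blast
  show fin: "finite (vertices \<Delta>)" by (rule finite_subset[OF sub S(1)])
  show "vertices \<Delta> \<subseteq> M" using sub S(2) by blast
  show hull: "\<Delta> = convex hull (vertices \<Delta>)"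
    unfolding vertices_def
    by (rule Krein_Milman_Minkowski) (use S in \<open>auto intro: finite_imp_compact_convex_hull\<close>)
  have "int (card (vertices \<Delta>)) = aff_dim (vertices \<Delta>) + 1"
    using assms hull aff_dim_convex_hull[of "vertices \<Delta>"] by (simp add: lattice_simplex_def)
  then show "\<not> affine_dependent (vertices \<Delta>)"
    using fin by (simp add: affine_independent_iff_card)
qed

section \<open>The lattice cone over a simplex\<close>

definition cone_lattice :: "'a::real_vector set \<Rightarrow> 'a set \<Rightarrow> ('a \<times> real) set" where
  "cone_lattice M V = {p. fst p \<in> M \<and> snd p \<in> \<int> \<and> p \<in> span (hat V)}"

text \<open>Scaling by \<open>1 / n\<close> brings a point of height \<open>n\<close> to height one,
  where nonnegative coordinates describe the simplex.\<close>

lemma slice_cone_lattice: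
  assumes V: "finite V" "V \<noteq> {}" and co: "dual_coords (hat V) co"
  shows "slice (hat V) (cone_lattice M V) co n = (\<lambda>x. (x, real n)) ` (dilate n (convex hull V) \<inter> M)"
proof (intro equalityI subsetI)
  fix p assume p: "p \<in> slice (hat V) (cone_lattice M V) co n"
  obtain x r where xr: "p = (x, r)" by (metis prod.collapse)
  have x: "x \<in> M" "(x, r) \<in> span (hat V)" "\<forall>w\<in>V. 0 \<le> co (w, 1) (x, r)" "(\<Sum>w\<in>V. co (w, 1) (x, r)) = real n"
    using p by (auto simp: slice_def cone_lattice_def xr hat_def sum.reindex inj_on_def)
  then have r: "r = real n" using hat_expand(2)[OF co x(2)] by simp
  have "x \<in> dilate n (convex hull V)"
  proof (cases "n = 0")
    \<comment> \<open>At height zero there is no scaling back; both sides reduce to the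
      origin.\<close>
    case True
    then have "\<forall>w\<in>V. co (w, 1) (x, r) = 0"
      using x(3,4) V(1) sum_nonneg_eq_0_iff[of V "\<lambda>w. co (w, 1) (x, r)"] by simp
    then have "x = 0" using hat_expand(1)[OF co x(2)] by simp
    moreover obtain v where "v \<in> convex hull V" using V(2) by (auto intro: hull_inc)
    ultimately show ?thesis unfolding dilate_def True by (intro image_eqI[of _ _ v]) auto
  next
    case False
    let ?y = "(1 / real n) *\<^sub>R x"
    have eq: "(1 / real n) *\<^sub>R (x, r) = (?y, 1)" using False by (simp add: r)
    have "(1 / real n) *\<^sub>R (x, r) \<in> span (hat V)" by (intro span_scale x(2))
    moreover have "0 \<le> co (w, 1) ((1 / real n) *\<^sub>R (x, r))" if "w \<in> V" for w
    proof -
      have "linear (co (w, 1))" using co that by (auto simp: dual_coords_def hat_def)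
      then show ?thesis using x(3) that by (simp only: linear_scale) simp
    qed
    ultimately have "?y \<in> convex hull V"
      unfolding convex_hull_hat[OF V(1) co] eq by blast
    then show ?thesis unfolding dilate_def using False by (intro image_eqI[of _ _ ?y]) auto
  qed
  then show "p \<in> (\<lambda>x. (x, real n)) ` (dilate n (convex hull V) \<inter> M)" using x(1) by (auto simp: xr r)
next
  fix p assume "p \<in> (\<lambda>x. (x, real n)) ` (dilate n (convex hull V) \<inter> M)"
  then obtain y where y: "y \<in> convex hull V" "real n *\<^sub>R y \<in> M" "p = real n *\<^sub>R (y, 1)"
    by (auto simp: dilate_def)
  have y': "(y, 1) \<in> span (hat V)" "\<forall>w\<in>V. 0 \<le> co (w, 1) (y, 1)"
    using y(1) convex_hull_hat[OF V(1) co] by auto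
  have p_span: "p \<in> span (hat V)" unfolding y(3) by (intro span_scale y'(1))
  have "0 \<le> co (w, 1) p" if "w \<in> V" for w
  proof -
    have "linear (co (w, 1))" using co that by (auto simp: dual_coords_def hat_def)
    then show ?thesis using y'(2) that unfolding y(3) by (simp only: linear_scale) simp
  qed
  moreover have "p \<in> cone_lattice M V" using y(2) p_span by (auto simp: cone_lattice_def y(3))
  moreover have "(\<Sum>q\<in>hat V. co q p) = real n"
    using hat_expand(2)[OF co p_span] by (simp add: sum_hat y(3))
  ultimately show "p \<in> slice (hat V) (cone_lattice M V) co n" by (auto simp: slice_def hat_def)
qed

lemma simplicial_cone_hat:
  fixes M V :: "'a::euclidean_space set"
  assumes M: "discrete_subgroup M" and V: "finite V" "V \<noteq> {}" "V \<subseteq> M" and co: "dual_coords (hat V) co"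
  shows "simplicial_cone (hat V) (cone_lattice M V) co"
proof (rule simplicial_cone.intro)
  show "finite (slice (hat V) (cone_lattice M V) co n)" for n
  proof -
    have "bounded (dilate n (convex hull V))"
      unfolding dilate_def by (intro bounded_scaling finite_imp_bounded_convex_hull V(1))
    then have "finite (M \<inter> dilate n (convex hull V))" by (rule discrete_subgroup_finite[OF M])
    then show ?thesis unfolding slice_cone_lattice[OF V(1,2) co] by (simp add: Int_commute)
  qed
  show "x = (\<Sum>v\<in>hat V. co v x *\<^sub>R v)" if "x \<in> cone_lattice M V" for x
    by (rule dual_coords_expand[OF co]) (use that in \<open>auto simp: cone_lattice_def\<close>)
  show "(\<Sum>v\<in>hat V. co v x) \<in> \<int>" if "x \<in> cone_lattice M V" for x
  proof -
    have "x \<in> span (hat V)" "snd x \<in> \<int>" using that by (auto simp: cone_lattice_def)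
    then show ?thesis using hat_expand(2)[OF co] by (simp add: sum_hat)
  qed
  show "x - y \<in> cone_lattice M V" if "x \<in> cone_lattice M V" "y \<in> cone_lattice M V" for x y
    using that by (simp add: cone_lattice_def discrete_subgroup_diff[OF M] span_diff)
  show "0 \<in> cone_lattice M V"
    using discrete_subgroup_zero[OF M] by (simp add: cone_lattice_def span_zero)
  show "hat V \<subseteq> cone_lattice M V"
    using V(3) span_superset[of "hat V"] by (auto simp: cone_lattice_def hat_def)
  show "linear (co v)" if "v \<in> hat V" for v
    using that co by (simp add: dual_coords_def)
  show "co v w = (if v = w then 1 else 0)" if "v \<in> hat V" "w \<in> hat V" for v w
    using that co by (simp add: dual_coords_def)
  show "hat V \<noteq> {}" using V(2) by (simp add: hat_def)
qed (use V(1) in simp)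

theorem corollary5p2:
  fixes M \<Delta> :: "'a::euclidean_space set"
  assumes "full_lattice M"
    and "lattice_simplex M \<Delta>"
    and "aff_dim \<Delta> > 0"
    and "idp M \<Delta>"
  shows "(clean M \<Delta> \<longleftrightarrow> (\<forall>F. F facet_of \<Delta> \<longrightarrow> unimodular M F)) \<and>
         (clean M \<Delta> \<longrightarrow> unimodal (hstar_vector M \<Delta>))"
proof -
  define V where "V = vertices \<Delta>"
  have M: "discrete_subgroup M" by (rule full_lattice_discrete_subgroup[OF assms(1)])
  have V: "finite V" "V \<subseteq> M" "\<not> affine_dependent V" and \<Delta>: "\<Delta> = convex hull V"
    using lattice_simplex_vertices[OF assms(2)] by (auto simp: V_def)
  have card: "card V = Suc (nat (aff_dim \<Delta>))" "2 \<le> card V"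
    using assms(2,3) by (auto simp: lattice_simplex_def V_def)
  have vertices_nonempty: "V \<noteq> {}" using card by auto
  have remove_nonempty: "V - {u} \<noteq> {}" for u
  proof
    assume "V - {u} = {}"
    then have "card V \<le> 1" using card_mono[of "{u}" V] by auto
    then show False using card by simp
  qed
  have facet: "F facet_of \<Delta> \<longleftrightarrow> (\<exists>u\<in>V. F = convex hull (V - {u}))" for F
    unfolding \<Delta> facet_of_convex_hull_affine_independent[OF V(3)] using remove_nonempty by auto
  have frontier: "rel_frontier \<Delta> = \<Union>{convex hull (V - {u}) |u. u \<in> V}"
    unfolding \<Delta> by (rule rel_frontier_convex_hull_cases[OF V(3)])
  obtain co where co: "dual_coords (hat V) co"
    using dual_coords_exist[of "hat V"] independent_hat V by auto
  let ?L = "cone_lattice M V"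
  have remove_indep: "\<not> affine_dependent (V - {u})" for u
    using V(3) affine_dependent_subset by blast
  \<comment> \<open>Dilates become slices, which transfers the decomposition property. A point with
    zero coordinate at a vertex lies on the opposite facet, where cleanness makes it a
    vertex.\<close>
  have cone: "clean_idp_cone (hat V) ?L co" if cl: "clean M \<Delta>"
  proof -
    interpret simplicial_cone "hat V" ?L co
      by (rule simplicial_cone_hat[OF M V(1) vertices_nonempty V(2) co])
    note slice = slice_cone_lattice[OF V(1) vertices_nonempty co, of M]
    show ?thesis
    proof
      fix p n assume p: "p \<in> S n"
      show "\<exists>y. (\<forall>i<n. y i \<in> S 1) \<and> p = (\<Sum>i<n. y i)"
      proof (cases "n = 0")
        case True
        then show ?thesis using p unfolding slice by (auto simp: dilate_def zero_prod_def)
      next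
        case False
        obtain z where z: "p = (z, real n)" "z \<in> dilate n \<Delta> \<inter> M" using p unfolding slice \<Delta> by blast
        then obtain y where y: "\<forall>i<n. y i \<in> \<Delta> \<inter> M" "z = (\<Sum>i<n. y i)"
          using assms(4) False unfolding idp_def by (metis One_nat_def Suc_leI neq0_conv)
        have "(y i, 1) \<in> S 1" if "i < n" for i
          using y(1) that unfolding slice \<Delta>[symmetric] by (simp add: dilate_def)
        moreover have "p = (\<Sum>i<n. (y i, 1))" by (simp add: z(1) y(2) prod_eq_iff fst_sum snd_sum)
        ultimately show ?thesis by (intro exI[of _ "\<lambda>i. (y i, 1)"]) simp
      qed
    next
      fix p v assume p: "p \<in> S 1" "v \<in> hat V" "co v p = 0"
      obtain x where x: "p = (x, 1)" "x \<in> \<Delta> \<inter> M"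
        using p(1) unfolding slice \<Delta>[symmetric] by (auto simp: dilate_def)
      obtain u where u: "u \<in> V" "v = (u, 1)" using p(2) by (auto simp: hat_def)
      have "x \<in> convex hull (V - {u})"
        using convex_hull_remove[OF V(1) co, of x u] x p(3) u \<Delta> by simp
      then have "x \<in> rel_frontier \<Delta> \<inter> M" using u(1) x(2) unfolding frontier by blast
      then show "p \<in> hat V" using cl x(1) unfolding clean_def V_def[symmetric] by (simp add: hat_def)
    qed
  qed
  have "unimodular M F" if cl: "clean M \<Delta>" and F: "F facet_of \<Delta>" for F
  proof -
    interpret clean_idp_cone "hat V" ?L co by (rule cone[OF cl])
    obtain u where u: "u \<in> V" "F = convex hull (V - {u})" using F facet by blast
    have sub: "hat (V - {u}) \<subseteq> hat V" by (auto simp: hat_def)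
    show ?thesis
      unfolding u(2)
    proof (rule unimodularI[OF M _ remove_nonempty _ remove_indep dual_coords_subset[OF co sub]])
      show "convex hull (V - {u}) \<inter> M \<subseteq> V - {u}"
      proof
        fix x assume x: "x \<in> convex hull (V - {u}) \<inter> M"
        then have "x \<in> rel_frontier \<Delta> \<inter> M" using u(1) unfolding frontier by blast
        then have "x \<in> V" using cl unfolding clean_def V_def[symmetric] by simp
        moreover have "u \<notin> convex hull (V - {u})"
          using V(3) u(1) convex_hull_subset_affine_hull[of "V - {u}"] by (auto simp: affine_dependent_def)
        ultimately show "x \<in> V - {u}" using x by blast
      qed
      fix x w assume x: "x \<in> M" "(x, 0) \<in> span (hat (V - {u}))" and w: "w \<in> V - {u}"
      \<comment> \<open>On the span of the facet opposite \<open>u\<close> the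
        \<open>u\<close>-coordinate vanishes, so \<open>face_integral\<close> makes the remaining
        coordinates integers.\<close>
      have "(x, 0) \<in> ?L" using x span_mono[OF sub] by (auto simp: cone_lattice_def)
      moreover have "co (u, 1) (x, 0) = 0"
      proof (rule linear_eq_0_on_span[OF _ _ x(2)])
        show "linear (co (u, 1))" using lin u(1) by (auto simp: hat_def)
        show "co (u, 1) p = 0" if "p \<in> hat (V - {u})" for p
          using that co_V[of "(u, 1)" p] u(1) by (auto simp: hat_def split: if_splits)
      qed
      ultimately show "co (w, 1) (x, 0) \<in> \<int>"
        using face_integral[of "(x, 0)" "(u, 1)" "(w, 1)"] u(1) w by (simp add: hat_def)
    qed (use V in auto)
  qed
  \<comment> \<open>The facets cover the frontier, and a unimodular facet has no lattice points
    besides its vertices.\<close>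
  moreover have "clean M \<Delta>" if unimod: "\<forall>F. F facet_of \<Delta> \<longrightarrow> unimodular M F"
    unfolding clean_def V_def[symmetric]
  proof (intro equalityI subsetI)
    fix x assume "x \<in> rel_frontier \<Delta> \<inter> M"
    then obtain u where u: "u \<in> V" "x \<in> convex hull (V - {u}) \<inter> M" unfolding frontier by blast
    then have "unimodular M (convex hull (V - {u}))" using unimod facet by blast
    then show "x \<in> V"
      using unimodularD[OF M _ remove_nonempty _ remove_indep] u(2) V by blast
  next
    fix x assume x: "x \<in> V"
    \<comment> \<open>There are at least two vertices, so \<open>x\<close> lies on the facet
      opposite another one.\<close>
    obtain u where u: "u \<in> V - {x}" using remove_nonempty[of x] by blast
    then have "x \<in> convex hull (V - {u})" using x by (intro hull_inc) auto
    then show "x \<in> rel_frontier \<Delta> \<inter> M" using u x V(2) unfolding frontier by blast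
  qed
  moreover have "unimodal (hstar_vector M \<Delta>)" if cl: "clean M \<Delta>"
  proof -
    interpret clean_idp_cone "hat V" ?L co by (rule cone[OF cl])
    have "card (S n) = card (dilate n \<Delta> \<inter> M)" for n
      unfolding slice_cone_lattice[OF V(1) vertices_nonempty co] \<Delta>[symmetric]
      by (rule card_image) (auto simp: inj_on_def)
    then have "ehrhart_series M \<Delta> * (1 - fps_X) ^ Suc (nat (aff_dim \<Delta>)) = Abs_fps (\<lambda>n. real (card (pbox n)))"
      using ehrhart_numerator by (simp add: ehrhart_series_def card(1) del: power_Suc)
    then have "hstar_vector M \<Delta> = map (\<lambda>n. real (card (pbox n))) [0..<Suc (nat (aff_dim \<Delta>))]"
      by (rule hstar_vector_eq) (use pbox_empty card(1) in simp)
    then show ?thesis using unimodal_pbox card by (simp del: upt_Suc)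
  qed
  ultimately show ?thesis by blast
qed

end
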